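(* Let $d$ be a positive integer and $G$ a graph. If $G$ is $\mathcal{R}_{d+1}$-connected, then there is an edge $e$ of $G$ such that $G-e$ is $\mathcal{R}_d$-connected.
   Context: For a graph $G=(V,E)$ and generic $p:V\to\mathbb{R}^d$ (coordinates algebraically independent over $\mathbb{Q}$), the rigidity matrix $R(G,p)$ has a row for each edge $ab$ with $p(a)-p(b)$ in the $d$ columns of $a$, $p(b)-p(a)$ in those of $b$, zeros elsewhere. The rigidity matroid $\mathcal{R}_d(G)$ is the matroid on $E$ given by linear independence of these rows (independent of the generic $p$). $G$ is $\mathcal{R}_d$-connected if $\mathcal{R}_d(G)$ is a connected matroid, i.e. every two edges lie in a common circuit. *)

theory Defs
  imports Complex_Main "HOL-Library.Poly_Mapping"
begin

definition simple_graph :: "'v set \<Rightarrow> 'v set set \<Rightarrow> bool" where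
  "simple_graph V E \<longleftrightarrow>
     finite V \<and> (\<forall>e\<in>E. \<exists>a\<in>V. \<exists>b\<in>V. a \<noteq> b \<and> e = {a, b})"

text \<open>A polynomial over \<open>\<rat>\<close> with variables from \<open>'x\<close> is a finitely supported map
  from monomials to coefficients, a monomial being a finitely supported exponent map.\<close>

definition eval_mpoly :: "('x \<Rightarrow> real) \<Rightarrow> (('x \<Rightarrow>\<^sub>0 nat) \<Rightarrow>\<^sub>0 rat) \<Rightarrow> real" where
  "eval_mpoly a q =
     (\<Sum>m\<in>Poly_Mapping.keys q. of_rat (Poly_Mapping.lookup q m) *
        (\<Prod>x\<in>Poly_Mapping.keys m. a x ^ Poly_Mapping.lookup m x))"

definition alg_indep_over_rat :: "'x set \<Rightarrow> ('x \<Rightarrow> real) \<Rightarrow> bool" where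
  "alg_indep_over_rat X a \<longleftrightarrow>
     (\<forall>q :: ('x \<Rightarrow>\<^sub>0 nat) \<Rightarrow>\<^sub>0 rat.
        (\<forall>m\<in>Poly_Mapping.keys q. Poly_Mapping.keys m \<subseteq> X) \<longrightarrow>
        eval_mpoly a q = 0 \<longrightarrow> q = 0)"

text \<open>A point of \<open>\<real>\<^sup>d\<close> is given by its coordinates with index \<open>i < d\<close>; all other values
  of \<open>p v\<close> are irrelevant.\<close>

definition generic :: "nat \<Rightarrow> 'v set \<Rightarrow> ('v \<Rightarrow> nat \<Rightarrow> real) \<Rightarrow> bool" where
  "generic d V p \<longleftrightarrow> alg_indep_over_rat (V \<times> {..<d}) (\<lambda>(v, i). p v i)"

text \<open>The entry in row \<open>e\<close> and in the \<open>i\<close>-th of the columns belonging to \<open>v\<close>.\<close>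

definition rigidity_matrix :: "('v \<Rightarrow> nat \<Rightarrow> real) \<Rightarrow> 'v set \<Rightarrow> 'v \<times> nat \<Rightarrow> real" where
  "rigidity_matrix p e = (\<lambda>(v, i). if v \<in> e then p v i - p (THE w. e = {v, w}) i else 0)"

lemma rigidity_matrix_edge:
  assumes "a \<noteq> b"
  shows "rigidity_matrix p {a, b} (a, i) = p a i - p b i"
    and "rigidity_matrix p {a, b} (b, i) = p b i - p a i"
    and "v \<notin> {a, b} \<Longrightarrow> rigidity_matrix p {a, b} (v, i) = 0"
proof -
  have "(THE w. {a, b} = {a, w}) = b" "(THE w. {a, b} = {b, w}) = a"
    by (rule the_equality; auto simp: doubleton_eq_iff)+
  then show "rigidity_matrix p {a, b} (a, i) = p a i - p b i"
    and "rigidity_matrix p {a, b} (b, i) = p b i - p a i"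
    by (simp_all add: rigidity_matrix_def)
  show "v \<notin> {a, b} \<Longrightarrow> rigidity_matrix p {a, b} (v, i) = 0"
    by (simp add: rigidity_matrix_def)
qed

definition rows_independent ::
    "nat \<Rightarrow> 'v set \<Rightarrow> ('v \<Rightarrow> nat \<Rightarrow> real) \<Rightarrow> 'v set set \<Rightarrow> bool" where
  "rows_independent d V p F \<longleftrightarrow>
     (\<forall>c :: 'v set \<Rightarrow> real.
        (\<forall>x \<in> V \<times> {..<d}. (\<Sum>e\<in>F. c e * rigidity_matrix p e x) = 0) \<longrightarrow>
        (\<forall>e\<in>F. c e = 0))"

text \<open>A matroid is given by its ground set \<open>E\<close> and its independence predicate.\<close>

definition circuit :: "'e set \<Rightarrow> ('e set \<Rightarrow> bool) \<Rightarrow> 'e set \<Rightarrow> bool" where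
  "circuit E indep C \<longleftrightarrow> C \<subseteq> E \<and> \<not> indep C \<and> (\<forall>D. D \<subset> C \<longrightarrow> indep D)"

definition matroid_connected :: "'e set \<Rightarrow> ('e set \<Rightarrow> bool) \<Rightarrow> bool" where
  "matroid_connected E indep \<longleftrightarrow>
     (\<forall>e\<in>E. \<forall>f\<in>E. e \<noteq> f \<longrightarrow> (\<exists>C. circuit E indep C \<and> e \<in> C \<and> f \<in> C))"

text \<open>Independence of rows does not depend on the choice of the generic \<open>p\<close>, and generic \<open>p\<close>
  exist for finite \<open>V\<close>, so that ``for some generic \<open>p\<close>'' and ``for all generic \<open>p\<close>'' agree.\<close>

definition rigidity_indep :: "nat \<Rightarrow> 'v set \<Rightarrow> 'v set set \<Rightarrow> 'v set set \<Rightarrow> bool" where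
  "rigidity_indep d V E F \<longleftrightarrow> F \<subseteq> E \<and> (\<exists>p. generic d V p \<and> rows_independent d V p F)"

definition rigidity_connected :: "nat \<Rightarrow> 'v set \<Rightarrow> 'v set set \<Rightarrow> bool" where
  "rigidity_connected d V E \<longleftrightarrow> matroid_connected E (rigidity_indep d V E)"

end

theory Submission
  imports Defs "HOL-Computational_Algebra.Polynomial"
begin

text \<open>In fact \<open>G - e\<close> is connected for every edge \<open>e = st\<close>. Suppose that \<open>E - e\<close> splits into \<open>A\<close> and
  \<open>B\<close> in dimension \<open>d\<close>. A stress \<open>\<omega>\<close> of a framework in dimension \<open>d + 1\<close> with \<open>\<omega>\<^sub>e = 1\<close> is also a
  stress of each of its coordinate projections to dimension \<open>d\<close>, so the load \<open>h\<^sub>i\<close> that \<open>\<omega>\<close>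
  restricted to \<open>A\<close> exerts in the \<open>i\<close>-th coordinate is determined by any \<open>d\<close> coordinates containing
  \<open>i\<close>, hence by the vector \<open>p\<^sub>i\<close> alone. Laplacians being symmetric, \<open>h\<^sub>i \<bullet> p\<^sub>j = h\<^sub>j \<bullet> p\<^sub>i\<close>. The projective
  map that inverts a coordinate vector \<open>\<lambda>\<close> turns its load into the negative divided by
  \<open>\<lambda>\<^sub>s \<lambda>\<^sub>t\<close>, and so \<open>\<Sum>\<^sub>w h\<^sub>i(w) (\<lambda>\<^sub>s \<lambda>\<^sub>t / \<lambda>\<^sub>w + \<lambda>\<^sub>w) = 0\<close> for generic \<open>\<lambda>\<close>. This forces \<open>h\<^sub>i\<close> to be
  a multiple of the row of \<open>e\<close>, with a factor independent of \<open>i\<close>. Hence the row of \<open>e\<close> is spanned by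
  the rows of \<open>A\<close> or by those of \<open>B\<close>, so the other part is a separator in dimension \<open>d\<close>, and then
  also in dimension \<open>d + 1\<close>.\<close>

section \<open>Circuits of a space of linear dependencies\<close>

definition supp :: "('e \<Rightarrow> real) \<Rightarrow> 'e set" where
  "supp c = {e. c e \<noteq> 0}"

text \<open>\<open>S\<close> models the linear dependencies of a family of vectors indexed by
  \<open>E\<close>. Working with this space instead of matroid axioms turns elimination into
  subtraction, and the same \<open>S\<close> later serves as a space of stresses.\<close>

locale dependency_space =
  fixes E :: "'e set" and S :: "('e \<Rightarrow> real) set"
  assumes finite_E: "finite E"
    and supp_subset: "c \<in> S \<Longrightarrow> supp c \<subseteq> E"
    and diff_scale: "c \<in> S \<Longrightarrow> c' \<in> S \<Longrightarrow> (\<lambda>e. c e - k * c' e) \<in> S"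
begin

definition elementary :: "('e \<Rightarrow> real) \<Rightarrow> bool" where
  "elementary c \<longleftrightarrow> c \<in> S \<and> supp c \<noteq> {} \<and> (\<forall>c'\<in>S. supp c' \<subset> supp c \<longrightarrow> supp c' = {})"

definition indep :: "'e set \<Rightarrow> bool" where
  "indep F \<longleftrightarrow> F \<subseteq> E \<and> (\<forall>c\<in>S. supp c \<subseteq> F \<longrightarrow> supp c = {})"

lemma finite_supp: "c \<in> S \<Longrightarrow> finite (supp c)"
  using finite_E finite_subset supp_subset by blast

lemma circuit_iff_elementary: "circuit E indep C \<longleftrightarrow> (\<exists>c. elementary c \<and> supp c = C)"
proof
  assume C: "circuit E indep C"
  then obtain c where c: "c \<in> S" "supp c \<subseteq> C" "supp c \<noteq> {}"
    unfolding circuit_def indep_def by blast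
  have "supp c = C"
    using C c unfolding circuit_def indep_def by blast
  moreover have "\<forall>c'\<in>S. supp c' \<subset> C \<longrightarrow> supp c' = {}"
    using C unfolding circuit_def indep_def by blast
  ultimately show "\<exists>c. elementary c \<and> supp c = C"
    using c unfolding elementary_def by blast
next
  assume "\<exists>c. elementary c \<and> supp c = C"
  then obtain c where c: "elementary c" "supp c = C" by blast
  then show "circuit E indep C"
    unfolding circuit_def indep_def elementary_def using supp_subset by blast
qed

text \<open>Among the vectors of \<open>S\<close> nonzero at \<open>e\<close> and supported in
  \<open>supp c\<close>, one with fewest nonzero entries is elementary: a vector of smaller support
  would either be nonzero at \<open>e\<close> itself, or could be subtracted to cancel a further
  entry without touching \<open>e\<close>.\<close>

lemma elementary_below:
  assumes "c \<in> S" "c e \<noteq> 0"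
  obtains c' where "elementary c'" "c' e \<noteq> 0" "supp c' \<subseteq> supp c"
proof -
  let ?P = "\<lambda>c'. c' \<in> S \<and> c' e \<noteq> 0 \<and> supp c' \<subseteq> supp c"
  define c' where "c' = arg_min (\<lambda>c. card (supp c)) ?P"
  have P: "?P c'" and min: "\<And>b. ?P b \<Longrightarrow> card (supp c') \<le> card (supp b)"
    using arg_min_nat_lemma[of ?P c "\<lambda>c. card (supp c)"] assms unfolding c'_def by auto
  have "supp b = {}" if b: "b \<in> S" "supp b \<subset> supp c'" for b
  proof (rule ccontr)
    assume ne: "supp b \<noteq> {}"
    show False
    proof (cases "b e = 0")
      case False
      then have "card (supp c') \<le> card (supp b)" using b P by (intro min) auto
      with b show False using finite_supp P psubset_card_mono by (metis linorder_not_less)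
    next
      case True
      obtain f where f: "b f \<noteq> 0" using ne by (auto simp: supp_def)
      define a where "a = (\<lambda>x. c' x - (c' f / b f) * b x)"
      have "a \<in> S" unfolding a_def using P b by (intro diff_scale) auto
      then have a: "a \<in> S" "a e \<noteq> 0" "a f = 0"
        using P True f by (auto simp: a_def)
      have "c' f \<noteq> 0" using f b by (auto simp: supp_def)
      moreover have "supp a \<subseteq> supp c'" using b by (auto simp: supp_def a_def)
      ultimately have "supp a \<subset> supp c'" using a by (auto simp: supp_def)
      moreover have "card (supp c') \<le> card (supp a)"
        using a P \<open>supp a \<subset> supp c'\<close> by (intro min) auto
      ultimately show False using finite_supp P psubset_card_mono by (metis linorder_not_less)
    qed
  qed
  moreover have "supp c' \<noteq> {}" using P by (auto simp: supp_def)
  ultimately have "elementary c'" using P unfolding elementary_def by blast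
  then show ?thesis using P that by blast
qed

text \<open>Strong circuit elimination. Subtracting the multiple of \<open>b\<close> that cancels
  \<open>f\<close> keeps the entry at \<open>e\<close>, because \<open>b\<close> vanishes there; an
  elementary vector through \<open>e\<close> lies below the difference.\<close>

lemma circuit_elimination:
  assumes C: "circuit E indep C" and D: "circuit E indep D"
    and e: "e \<in> C" "e \<notin> D" and f: "f \<in> C" "f \<in> D"
  obtains C' where "circuit E indep C'" "e \<in> C'" "C' \<subseteq> C \<union> D - {f}"
proof -
  obtain c where c: "elementary c" "supp c = C" using C circuit_iff_elementary by auto
  obtain b where b: "elementary b" "supp b = D" using D circuit_iff_elementary by auto
  define a where "a = (\<lambda>x. c x - (c f / b f) * b x)"
  have bf: "b f \<noteq> 0" using b f by (auto simp: supp_def)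
  have be: "b e = 0" "c e \<noteq> 0" using b c e by (auto simp: supp_def)
  have "a \<in> S" unfolding a_def using b c by (intro diff_scale) (auto simp: elementary_def)
  then have a: "a \<in> S" "a e \<noteq> 0" "a f = 0"
    using bf be by (auto simp: a_def)
  have sa: "supp a \<subseteq> C \<union> D - {f}"
    using b c a by (auto simp: supp_def a_def)
  obtain c' where "elementary c'" "c' e \<noteq> 0" "supp c' \<subseteq> supp a"
    using elementary_below[OF a(1,2)] .
  then show ?thesis
    using that[of "supp c'"] sa circuit_iff_elementary by (auto simp: supp_def)
qed

lemma circuit_subset_eq: "circuit E indep C \<Longrightarrow> circuit E indep D \<Longrightarrow> C \<subseteq> D \<Longrightarrow> C = D"
  unfolding circuit_def by blast

text \<open>A pair \<open>C, D\<close> with smallest union is replaced by one whose union avoids a common element.\<close>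

lemma common_circuit:
  assumes "circuit E indep C" "circuit E indep D" "e \<in> C" "g \<in> D" "C \<inter> D \<noteq> {}"
  shows "\<exists>C'. circuit E indep C' \<and> e \<in> C' \<and> g \<in> C'"
  using assms
proof (induction "card (C \<union> D)" arbitrary: C D rule: less_induct)
  case less
  show ?case
  proof (rule ccontr)
    assume no: "\<not> ?thesis"
    have fin: "finite (C \<union> D)"
      using less.prems(1,2) by (auto simp: circuit_def intro: finite_subset[OF _ finite_E])
    have minimal: "C' \<union> D' = C \<union> D" if "circuit E indep C'" "circuit E indep D'" "e \<in> C'" "g \<in> D'"
      "C' \<inter> D' \<noteq> {}" "C' \<union> D' \<subseteq> C \<union> D" for C' D'
    proof (rule ccontr)
      assume "C' \<union> D' \<noteq> C \<union> D"
      then have "card (C' \<union> D') < card (C \<union> D)"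
        using that fin by (intro psubset_card_mono) auto
      then show False using less.hyps[OF _ that(1-5)] no by blast
    qed
    obtain f where f: "f \<in> C" "f \<in> D" using less.prems by blast
    have eg: "e \<notin> D" "g \<notin> C" using no less.prems by blast+
    obtain C' where C': "circuit E indep C'" "e \<in> C'" "C' \<subseteq> C \<union> D - {f}"
      using circuit_elimination[OF less.prems(1,2) less.prems(3) eg(1) f] .
    obtain D' where D': "circuit E indep D'" "g \<in> D'" "D' \<subseteq> D \<union> C - {f}"
      using circuit_elimination[OF less.prems(2,1) less.prems(4) eg(2) f(2,1)] .
    have "\<not> C' \<subseteq> C" "\<not> D' \<subseteq> D"
      using circuit_subset_eq[OF C'(1) less.prems(1)] circuit_subset_eq[OF D'(1) less.prems(2)]
        C'(3) D'(3) f by blast+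
    \<comment> \<open>By minimality the pair \<open>C, D'\<close> still covers \<open>D - C\<close>,
      so \<open>D'\<close> meets \<open>C'\<close>. Then the pair \<open>C', D'\<close> has to cover
      everything, although both miss \<open>f\<close>.\<close>
    then have "C' \<inter> (D - C) \<noteq> {}" "D' \<inter> (C - D) \<noteq> {}" using C'(3) D'(3) by blast+
    then have "C \<union> D' = C \<union> D"
      using D' by (intro minimal[OF less.prems(1) D'(1) less.prems(3) D'(2)]) auto
    then have "C' \<inter> D' \<noteq> {}" using \<open>C' \<inter> (D - C) \<noteq> {}\<close> by blast
    then have "C' \<union> D' = C \<union> D"
      using C'(3) D'(3) by (intro minimal[OF C'(1) D'(1) C'(2) D'(2)]) auto
    then show False using C'(3) D'(3) f by blast
  qed
qed

lemma separator_exists: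
  assumes "\<not> matroid_connected E indep"
  obtains A where "A \<subseteq> E" "A \<noteq> {}" "A \<noteq> E"
    "\<And>C. circuit E indep C \<Longrightarrow> C \<subseteq> A \<or> C \<inter> A = {}"
proof -
  obtain f g where fg: "f \<in> E" "g \<in> E" "f \<noteq> g"
    and no: "\<not> (\<exists>C. circuit E indep C \<and> f \<in> C \<and> g \<in> C)"
    using assms unfolding matroid_connected_def by blast
  \<comment> \<open>The connectivity class of \<open>f\<close>; \<open>f\<close> is inserted because
    it may lie in no circuit.\<close>
  define A where "A = insert f {a. \<exists>C. circuit E indep C \<and> f \<in> C \<and> a \<in> C}"
  have "A \<subseteq> E" using fg by (auto simp: A_def circuit_def)
  moreover have "g \<notin> A" using fg no by (auto simp: A_def)
  moreover have "C \<subseteq> A" if C: "circuit E indep C" "C \<inter> A \<noteq> {}" for C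
  proof (cases "f \<in> C")
    case True
    then show ?thesis using C by (auto simp: A_def)
  next
    case False
    then obtain D where "circuit E indep D" "f \<in> D" "D \<inter> C \<noteq> {}"
      using C by (auto simp: A_def)
    then show ?thesis using common_circuit[of D C f] C by (auto simp: A_def)
  qed
  ultimately show ?thesis using that[of A] fg A_def by blast
qed

text \<open>Elementary vectors are peeled off \<open>c\<close> one at a time. Each lies wholly
  inside or wholly outside \<open>A\<close>, so restriction to \<open>A\<close> keeps some summands
  and drops the others.\<close>

lemma separator_splits:
  assumes sep: "\<And>C. circuit E indep C \<Longrightarrow> C \<subseteq> A \<or> C \<inter> A = {}" and "c \<in> S"
  shows "(\<lambda>e. if e \<in> A then c e else 0) \<in> S"
  using \<open>c \<in> S\<close>
proof (induction "card (supp c)" arbitrary: c rule: less_induct)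
  case less
  show ?case
  proof (cases "supp c = {}")
    case True
    then have "(\<lambda>e. if e \<in> A then c e else 0) = c" by (auto simp: supp_def)
    then show ?thesis using less.prems by simp
  next
    case False
    then obtain e where e: "c e \<noteq> 0" by (auto simp: supp_def)
    then obtain b where b: "elementary b" "b e \<noteq> 0" "supp b \<subseteq> supp c"
      using elementary_below less.prems by blast
    have bS: "b \<in> S" using b by (simp add: elementary_def)
    define k where "k = c e / b e"
    define a where "a = (\<lambda>x. c x - k * b x)"
    have "a \<in> S" unfolding a_def using less.prems bS by (rule diff_scale)
    then have a: "a \<in> S" "a e = 0"
      using b by (auto simp: a_def k_def)
    have "supp a \<subset> supp c"
      using b a e by (auto simp: supp_def a_def)
    then have "card (supp a) < card (supp c)"
      using finite_supp[OF less.prems] psubset_card_mono by blast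
    then have aA: "(\<lambda>e. if e \<in> A then a e else 0) \<in> S" using less.hyps a by blast
    have "supp b \<subseteq> A \<or> supp b \<inter> A = {}"
      using sep circuit_iff_elementary b by blast
    then show ?thesis
    proof
      assume "supp b \<subseteq> A"
      then have "(\<lambda>e. if e \<in> A then c e else 0) = (\<lambda>e. (if e \<in> A then a e else 0) - (- k) * b e)"
        by (auto simp: a_def supp_def fun_eq_iff)
      then show ?thesis using diff_scale[OF aA bS, of "- k"] by simp
    next
      assume "supp b \<inter> A = {}"
      then have "(\<lambda>e. if e \<in> A then c e else 0) = (\<lambda>e. if e \<in> A then a e else 0)"
        by (auto simp: a_def supp_def fun_eq_iff)
      then show ?thesis using aA by simp
    qed
  qed
qed

end

section \<open>Polynomial functions and generic points\<close>

text \<open>Polynomials as functions of the configuration, with coefficients from \<open>K\<close>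
  and variables from \<open>X\<close>. Statements on generic points use \<open>K = \<rat>\<close>;
  \<open>UNIV\<close> suffices to find points that avoid finitely many bad sets.\<close>

inductive_set poly_fun :: "real set \<Rightarrow> ('v \<times> nat) set \<Rightarrow> (('v \<Rightarrow> nat \<Rightarrow> real) \<Rightarrow> real) set"
  for K X where
  const: "c \<in> K \<Longrightarrow> (\<lambda>p. c) \<in> poly_fun K X"
| coord: "(v, i) \<in> X \<Longrightarrow> (\<lambda>p. p v i) \<in> poly_fun K X"
| add: "f \<in> poly_fun K X \<Longrightarrow> g \<in> poly_fun K X \<Longrightarrow> (\<lambda>p. f p + g p) \<in> poly_fun K X"
| diff: "f \<in> poly_fun K X \<Longrightarrow> g \<in> poly_fun K X \<Longrightarrow> (\<lambda>p. f p - g p) \<in> poly_fun K X"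
| mult: "f \<in> poly_fun K X \<Longrightarrow> g \<in> poly_fun K X \<Longrightarrow> (\<lambda>p. f p * g p) \<in> poly_fun K X"

lemma poly_fun_sum:
  assumes "0 \<in> K" "\<And>a. a \<in> A \<Longrightarrow> f a \<in> poly_fun K X"
  shows "(\<lambda>p. \<Sum>a\<in>A. f a p) \<in> poly_fun K X"
  using assms(2)
  by (induction A rule: infinite_finite_induct) (auto intro: poly_fun.intros assms(1))

lemma poly_fun_prod:
  assumes "1 \<in> K" "\<And>a. a \<in> A \<Longrightarrow> f a \<in> poly_fun K X"
  shows "(\<lambda>p. \<Prod>a\<in>A. f a p) \<in> poly_fun K X"
  using assms(2)
  by (induction A rule: infinite_finite_induct) (auto intro: poly_fun.intros assms(1))

lemma poly_fun_power:
  assumes "1 \<in> K" "f \<in> poly_fun K X"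
  shows "(\<lambda>p. f p ^ n) \<in> poly_fun K X"
  by (induction n) (auto intro: poly_fun.intros assms)

lemma poly_fun_on_line:
  assumes "f \<in> poly_fun K X"
  shows "\<exists>P. \<forall>t. f (\<lambda>v i. p v i + t * q v i) = poly P t"
  using assms
proof induction
  case (const c)
  then show ?case by (intro exI[of _ "[:c:]"]) simp
next
  case (coord v i)
  then show ?case by (intro exI[of _ "[:p v i, q v i:]"]) simp
next
  case (add f g)
  then show ?case by (metis poly_add)
next
  case (diff f g)
  then show ?case by (metis poly_diff)
next
  case (mult f g)
  then show ?case by (metis poly_mult)
qed

text \<open>On the line through a non-zero of \<open>f\<close> and a non-zero of \<open>g\<close>, both functions are non-zero
  polynomials in one variable.\<close>

lemma poly_fun_common_nonzero:
  assumes "f \<in> poly_fun K X" "g \<in> poly_fun K' X'" "f p \<noteq> 0" "g q \<noteq> 0"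
  obtains t r where "r = (\<lambda>v i. p v i + t * (q v i - p v i))" "f r \<noteq> 0" "g r \<noteq> 0"
proof -
  let ?r = "\<lambda>t v i. p v i + t * (q v i - p v i)"
  obtain P where P: "\<And>t. f (?r t) = poly P t"
    using poly_fun_on_line[OF assms(1)] by metis
  obtain Q where Q: "\<And>t. g (?r t) = poly Q t"
    using poly_fun_on_line[OF assms(2)] by metis
  have "poly P 0 \<noteq> 0" "poly Q 1 \<noteq> 0"
    using assms(3,4) by (simp_all flip: P Q)
  then have "P * Q \<noteq> 0" by auto
  then have "finite {t. poly (P * Q) t = 0}" by (rule poly_roots_finite)
  then obtain t where "poly (P * Q) t \<noteq> 0"
    using ex_new_if_finite[OF infinite_UNIV_char_0] by blast
  then show ?thesis using that[of "?r t" t] P Q by auto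
qed

lemma poly_fun_prod_nonzero:
  assumes "finite A" "1 \<in> K" "\<And>a. a \<in> A \<Longrightarrow> f a \<in> poly_fun K X" "\<And>a. a \<in> A \<Longrightarrow> \<exists>p. f a p \<noteq> 0"
  shows "\<exists>p. (\<Prod>a\<in>A. f a p) \<noteq> 0"
  using assms(1,3,4)
proof (induction A)
  case (insert a A)
  then obtain p q where pq: "f a p \<noteq> 0" "(\<Prod>a\<in>A. f a q) \<noteq> 0" by (metis insertCI)
  have prod: "(\<lambda>p. \<Prod>a\<in>A. f a p) \<in> poly_fun K X"
    using insert assms(2) by (intro poly_fun_prod) auto
  obtain t r where "r = (\<lambda>v i. p v i + t * (q v i - p v i))" "f a r \<noteq> 0" "(\<Prod>a\<in>A. f a r) \<noteq> 0"
    by (rule poly_fun_common_nonzero[where f = "f a" and g = "\<lambda>p. \<Prod>a\<in>A. f a p" and p = p and q = q,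
          OF insert.prems(1)[OF insertI1] prod pq])
  then show ?case
    using insert.hyps by (intro exI[of _ r]) simp
qed simp

text \<open>The certificate is the product of the pivots of a fraction-free Gaussian elimination.\<close>

lemma independence_certificate:
  fixes R :: "'e \<Rightarrow> 'x \<Rightarrow> ('v \<Rightarrow> nat \<Rightarrow> real) \<Rightarrow> real"
  assumes "finite F" "1 \<in> K" "\<And>e x. e \<in> F \<Longrightarrow> x \<in> Y \<Longrightarrow> R e x \<in> poly_fun K X"
    and "\<And>c. (\<forall>x\<in>Y. (\<Sum>e\<in>F. c e * R e x p) = 0) \<Longrightarrow> \<forall>e\<in>F. c e = 0"
  shows "\<exists>D\<in>poly_fun K X. D p \<noteq> 0 \<and>
    (\<forall>q c. D q \<noteq> 0 \<longrightarrow> (\<forall>x\<in>Y. (\<Sum>e\<in>F. c e * R e x q) = 0) \<longrightarrow> (\<forall>e\<in>F. c e = (0::real)))"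
  using assms(1,3,4)
proof (induction F arbitrary: R)
  case empty
  then show ?case by (intro bexI[of _ "\<lambda>p. 1"]) (auto intro: poly_fun.const assms(2))
next
  case (insert a F)
  have "\<exists>x\<in>Y. R a x p \<noteq> 0"
  proof (rule ccontr)
    assume "\<not> ?thesis"
    then have "\<forall>x\<in>Y. (\<Sum>e\<in>insert a F. (if e = a then 1 else 0) * R e x p) = 0"
      using insert.hyps by (auto intro!: sum.neutral)
    then show False using insert.prems(2)[of "\<lambda>e. if e = a then 1 else 0"] by auto
  qed
  then obtain x where x: "x \<in> Y" "R a x p \<noteq> 0" by blast
  \<comment> \<open>Cross-multiplying with the pivot \<open>R a x\<close> clears column
    \<open>x\<close> without division, so the entries remain polynomial functions.\<close>
  define R' where "R' = (\<lambda>e y q. R a x q * R e y q - R e x q * R a y q)"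
  have comb: "(\<Sum>e\<in>F. c e * R' e y q)
      = R a x q * (\<Sum>e\<in>F. c e * R e y q) - (\<Sum>e\<in>F. c e * R e x q) * R a y q" for c y q
    by (simp add: R'_def sum_distrib_left sum_distrib_right sum_subtractf[symmetric] algebra_simps)
  have "\<exists>D\<in>poly_fun K X. D p \<noteq> 0 \<and>
    (\<forall>q c. D q \<noteq> 0 \<longrightarrow> (\<forall>x\<in>Y. (\<Sum>e\<in>F. c e * R' e x q) = 0) \<longrightarrow> (\<forall>e\<in>F. c e = (0::real)))"
  proof (rule insert.IH)
    show "R' e y \<in> poly_fun K X" if "e \<in> F" "y \<in> Y" for e y
      using that x insert.prems(1) unfolding R'_def
      by (auto intro!: poly_fun.diff poly_fun.mult)
  next
    fix c :: "'e \<Rightarrow> real"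
    assume c: "\<forall>y\<in>Y. (\<Sum>e\<in>F. c e * R' e y p) = 0"
    \<comment> \<open>A dependency of the reduced rows extends to the original ones: the coefficient
      of \<open>a\<close> is chosen to cancel column \<open>x\<close>.\<close>
    define b where "b = c(a := - (\<Sum>e\<in>F. c e * R e x p) / R a x p)"
    have "(\<Sum>e\<in>F. b e * R e y p) = (\<Sum>e\<in>F. c e * R e y p)" for y
      using insert.hyps by (intro sum.cong) (auto simp: b_def)
    then have "\<forall>y\<in>Y. (\<Sum>e\<in>insert a F. b e * R e y p) = 0"
      using c x insert.hyps unfolding comb by (auto simp: b_def field_simps)
    then have "\<forall>e\<in>insert a F. b e = 0" by (rule insert.prems(2))
    then show "\<forall>e\<in>F. c e = 0" using insert.hyps by (auto simp: b_def split: if_splits)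
  qed
  then obtain D where D: "D \<in> poly_fun K X" "D p \<noteq> 0"
    "\<And>q c. D q \<noteq> 0 \<Longrightarrow> (\<forall>x\<in>Y. (\<Sum>e\<in>F. c e * R' e x q) = 0) \<Longrightarrow> (\<forall>e\<in>F. c e = (0::real))"
    by blast
  show ?case
  proof (intro bexI[of _ "\<lambda>q. R a x q * D q"] conjI allI impI)
    show "(\<lambda>q. R a x q * D q) \<in> poly_fun K X"
      using D x insert.prems(1) by (auto intro!: poly_fun.mult)
    show "R a x p * D p \<noteq> 0" using x D by simp
  next
    fix q and c :: "'e \<Rightarrow> real"
    assume q: "R a x q * D q \<noteq> 0" and c: "\<forall>x\<in>Y. (\<Sum>e\<in>insert a F. c e * R e x q) = 0"
    have c': "(\<Sum>e\<in>F. c e * R e y q) = - c a * R a y q" if "y \<in> Y" for y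
      using c that insert.hyps by (auto simp: eq_neg_iff_add_eq_0 add.commute)
    have F0: "\<forall>e\<in>F. c e = 0"
      using q x by (intro D(3)[of q]) (auto simp: comb c')
    then have "c a * R a x q = 0" using c' x by simp
    then show "\<forall>e\<in>insert a F. c e = 0" using F0 q by auto
  qed
qed

section \<open>Evaluation of formal polynomials over the rationals\<close>

lemma eval_mpoly_superset:
  assumes "finite M" "Poly_Mapping.keys q \<subseteq> M"
  shows "eval_mpoly a q = (\<Sum>m\<in>M. of_rat (Poly_Mapping.lookup q m) *
    (\<Prod>x\<in>Poly_Mapping.keys m. a x ^ Poly_Mapping.lookup m x))"
  unfolding eval_mpoly_def using assms
  by (intro sum.mono_neutral_left) (auto simp: in_keys_iff)

lemma monomial_eval_superset:
  assumes "finite M" "Poly_Mapping.keys m \<subseteq> M"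
  shows "(\<Prod>x\<in>Poly_Mapping.keys m. a x ^ Poly_Mapping.lookup m x)
    = (\<Prod>x\<in>M. (a x :: real) ^ Poly_Mapping.lookup m x)"
  using assms by (intro prod.mono_neutral_left) (auto simp: in_keys_iff)

lemma monomial_eval_add:
  "(\<Prod>x\<in>Poly_Mapping.keys (m + n). a x ^ Poly_Mapping.lookup (m + n) x)
    = (\<Prod>x\<in>Poly_Mapping.keys m. a x ^ Poly_Mapping.lookup m x)
      * (\<Prod>x\<in>Poly_Mapping.keys n. (a x :: real) ^ Poly_Mapping.lookup n x)"
proof -
  let ?M = "Poly_Mapping.keys m \<union> Poly_Mapping.keys n"
  have "Poly_Mapping.keys (m + n) \<subseteq> ?M" by (rule Poly_Mapping.keys_add)
  then show ?thesis
    using monomial_eval_superset[of ?M "m + n" a] monomial_eval_superset[of ?M m a]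
      monomial_eval_superset[of ?M n a]
    by (simp add: lookup_add power_add prod.distrib)
qed

lemma eval_mpoly_zero [simp]: "eval_mpoly a 0 = 0"
  by (simp add: eval_mpoly_def)

lemma eval_mpoly_single:
  "eval_mpoly a (Poly_Mapping.single m c)
    = of_rat c * (\<Prod>x\<in>Poly_Mapping.keys m. a x ^ Poly_Mapping.lookup m x)"
  by (simp add: eval_mpoly_def)

lemma eval_mpoly_add: "eval_mpoly a (q + r) = eval_mpoly a q + eval_mpoly a r"
proof -
  let ?M = "Poly_Mapping.keys q \<union> Poly_Mapping.keys r"
  have "Poly_Mapping.keys (q + r) \<subseteq> ?M" by (rule Poly_Mapping.keys_add)
  then show ?thesis
    by (simp add: eval_mpoly_superset[of ?M] lookup_add of_rat_add distrib_right sum.distrib)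
qed

lemma eval_mpoly_diff: "eval_mpoly a (q - r) = eval_mpoly a q - eval_mpoly a r"
  using eval_mpoly_add[of a "q - r" r] by simp

lemma eval_mpoly_sum: "eval_mpoly a (\<Sum>i\<in>I. q i) = (\<Sum>i\<in>I. eval_mpoly a (q i))"
  by (induction I rule: infinite_finite_induct) (auto simp: eval_mpoly_add)

lemma poly_mapping_eq_sum_single:
  "q = (\<Sum>m\<in>Poly_Mapping.keys q. Poly_Mapping.single m (Poly_Mapping.lookup q m))"
  by (rule poly_mapping_eqI) (auto simp: lookup_sum lookup_single when_def in_keys_iff)

lemma eval_mpoly_mult: "eval_mpoly a (q * r) = eval_mpoly a q * eval_mpoly a r"
proof -
  let ?s = "\<lambda>q m. Poly_Mapping.single m (Poly_Mapping.lookup q m)"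
  have eval: "eval_mpoly a q = (\<Sum>m\<in>Poly_Mapping.keys q. eval_mpoly a (?s q m))" for q
    by (subst eval_mpoly_def) (simp add: eval_mpoly_single)
  have "q * r = (\<Sum>m\<in>Poly_Mapping.keys q. ?s q m) * (\<Sum>n\<in>Poly_Mapping.keys r. ?s r n)"
    by (intro arg_cong2[of _ _ _ _ "(*)"] poly_mapping_eq_sum_single)
  also have "\<dots> = (\<Sum>m\<in>Poly_Mapping.keys q. \<Sum>n\<in>Poly_Mapping.keys r. ?s q m * ?s r n)"
    by (rule sum_product)
  finally have "eval_mpoly a (q * r)
      = (\<Sum>m\<in>Poly_Mapping.keys q. \<Sum>n\<in>Poly_Mapping.keys r. eval_mpoly a (?s q m * ?s r n))"
    by (simp only: eval_mpoly_sum)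
  also have "\<dots> = (\<Sum>m\<in>Poly_Mapping.keys q. \<Sum>n\<in>Poly_Mapping.keys r.
      eval_mpoly a (?s q m) * eval_mpoly a (?s r n))"
    by (intro sum.cong refl)
      (simp only: mult_single eval_mpoly_single monomial_eval_add of_rat_mult mult_ac)
  also have "\<dots> = eval_mpoly a q * eval_mpoly a r"
    by (simp only: sum_product[symmetric] eval[symmetric])
  finally show ?thesis .
qed

lemma keys_keys_mult:
  assumes "\<forall>m\<in>Poly_Mapping.keys q. Poly_Mapping.keys m \<subseteq> X"
    and "\<forall>m\<in>Poly_Mapping.keys r. Poly_Mapping.keys m \<subseteq> X"
  shows "\<forall>m\<in>Poly_Mapping.keys (q * r). Poly_Mapping.keys (m :: 'x \<Rightarrow>\<^sub>0 nat) \<subseteq> X"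
proof
  fix m assume "m \<in> Poly_Mapping.keys (q * r)"
  then obtain a b where "m = a + b" "a \<in> Poly_Mapping.keys q" "b \<in> Poly_Mapping.keys r"
    using keys_mult[of q r] by blast
  then show "Poly_Mapping.keys m \<subseteq> X"
    using assms Poly_Mapping.keys_add[of a b] by blast
qed

lemma poly_fun_eval_mpoly:
  assumes "f \<in> poly_fun \<rat> X"
  shows "\<exists>q. (\<forall>m\<in>Poly_Mapping.keys q. Poly_Mapping.keys m \<subseteq> X) \<and>
    (\<forall>p. f p = eval_mpoly (\<lambda>(v, i). p v i) q)"
  using assms
proof induction
  case (const c)
  then obtain r where "c = of_rat r" by (auto elim: Rats_cases)
  then show ?case
    by (intro exI[of _ "Poly_Mapping.single 0 r"]) (auto simp: eval_mpoly_single split: if_splits)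
next
  case (coord v i)
  then show ?case
    by (intro exI[of _ "Poly_Mapping.single (Poly_Mapping.single (v, i) 1) 1"])
      (auto simp: eval_mpoly_single)
next
  case (add f g)
  then obtain q r where "\<forall>m\<in>Poly_Mapping.keys q. Poly_Mapping.keys m \<subseteq> X"
    "\<forall>m\<in>Poly_Mapping.keys r. Poly_Mapping.keys m \<subseteq> X"
    "\<forall>p. f p = eval_mpoly (\<lambda>(v, i). p v i) q" "\<forall>p. g p = eval_mpoly (\<lambda>(v, i). p v i) r"
    by blast
  then show ?case
    using Poly_Mapping.keys_add[of q r]
    by (intro exI[of _ "q + r"] conjI) (blast, simp add: eval_mpoly_add)
next
  case (diff f g)
  then obtain q r where "\<forall>m\<in>Poly_Mapping.keys q. Poly_Mapping.keys m \<subseteq> X"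
    "\<forall>m\<in>Poly_Mapping.keys r. Poly_Mapping.keys m \<subseteq> X"
    "\<forall>p. f p = eval_mpoly (\<lambda>(v, i). p v i) q" "\<forall>p. g p = eval_mpoly (\<lambda>(v, i). p v i) r"
    by blast
  then show ?case
    using keys_diff[of q r]
    by (intro exI[of _ "q - r"] conjI) (blast, simp add: eval_mpoly_diff)
next
  case (mult f g)
  then obtain q r where "\<forall>m\<in>Poly_Mapping.keys q. Poly_Mapping.keys m \<subseteq> X"
    "\<forall>m\<in>Poly_Mapping.keys r. Poly_Mapping.keys m \<subseteq> X"
    "\<forall>p. f p = eval_mpoly (\<lambda>(v, i). p v i) q" "\<forall>p. g p = eval_mpoly (\<lambda>(v, i). p v i) r"
    by blast
  then show ?case
    using keys_keys_mult[of q X r]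
    by (intro exI[of _ "q * r"] conjI) (blast, simp add: eval_mpoly_mult)
qed

text \<open>If \<open>f\<close> vanished at \<open>p\<close>, the formal polynomial behind it would
  be zero, and \<open>f\<close> would vanish at \<open>p'\<close> too.\<close>

lemma poly_fun_nonzero_at_generic:
  assumes "f \<in> poly_fun \<rat> (V \<times> {..<d})" "generic d V p" "f p' \<noteq> 0"
  shows "f p \<noteq> 0"
proof -
  obtain q where "\<forall>m\<in>Poly_Mapping.keys q. Poly_Mapping.keys m \<subseteq> V \<times> {..<d}"
    "\<And>p. f p = eval_mpoly (\<lambda>(v, i). p v i) q"
    using poly_fun_eval_mpoly[OF assms(1)] by blast
  then show ?thesis
    using assms(2,3) unfolding generic_def alg_indep_over_rat_def by fastforce
qed

section \<open>Stresses and loads of frameworks\<close>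

text \<open>The index set \<open>J\<close> selects coordinates: a configuration \<open>p\<close> with many coordinates serves as a
  pool from which frameworks of dimension \<open>card J\<close> are taken.\<close>

definition load :: "'v set set \<Rightarrow> ('v \<Rightarrow> nat \<Rightarrow> real) \<Rightarrow> ('v set \<Rightarrow> real) \<Rightarrow> nat \<Rightarrow> 'v \<Rightarrow> real" where
  "load F p c i v = (\<Sum>e\<in>F. c e * rigidity_matrix p e (v, i))"

definition stress :: "nat set \<Rightarrow> 'v set \<Rightarrow> ('v \<Rightarrow> nat \<Rightarrow> real) \<Rightarrow> 'v set set \<Rightarrow> ('v set \<Rightarrow> real) \<Rightarrow> bool"
  where "stress J V p F c \<longleftrightarrow> (\<forall>i\<in>J. \<forall>v\<in>V. load F p c i v = 0)"

definition rows_independent_on ::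
    "nat set \<Rightarrow> 'v set \<Rightarrow> ('v \<Rightarrow> nat \<Rightarrow> real) \<Rightarrow> 'v set set \<Rightarrow> bool" where
  "rows_independent_on J V p F \<longleftrightarrow> (\<forall>c. stress J V p F c \<longrightarrow> (\<forall>e\<in>F. c e = 0))"

text \<open>Independence in the generic rigidity matroid, expressed without genericity: one
  placement with independent rows is enough, as independence then passes to every generic
  placement.\<close>

definition realizable :: "nat \<Rightarrow> 'v set \<Rightarrow> 'v set set \<Rightarrow> bool" where
  "realizable d V F \<longleftrightarrow> (\<exists>p. rows_independent d V p F)"

text \<open>A substitute for genericity that asks only for finitely many independence conditions. It
  can therefore be enforced by a single polynomial, also at the image of a configuration under a
  projective map.\<close>

definition regular :: "'v set \<Rightarrow> 'v set set \<Rightarrow> ('v \<Rightarrow> nat \<Rightarrow> real) \<Rightarrow> nat set \<Rightarrow> bool" where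
  "regular V E p J \<longleftrightarrow> (\<forall>F\<subseteq>E. realizable (card J) V F \<longrightarrow> rows_independent_on J V p F)"

lemma rows_independent_iff_on: "rows_independent d V p F \<longleftrightarrow> rows_independent_on {..<d} V p F"
  unfolding rows_independent_def rows_independent_on_def stress_def load_def by auto

lemma rigidity_matrix_reindex:
  "rigidity_matrix (\<lambda>v i. p v (\<beta> i)) e (v, i) = rigidity_matrix p e (v, \<beta> i)"
  by (simp add: rigidity_matrix_def)

lemma rows_independent_on_reindex:
  "rows_independent_on I V (\<lambda>v i. p v (\<beta> i)) F \<longleftrightarrow> rows_independent_on (\<beta> ` I) V p F"
  by (simp add: rows_independent_on_def stress_def load_def rigidity_matrix_reindex)

lemma rows_independent_on_realizable:
  assumes "rows_independent_on J V p F" "finite J"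
  shows "realizable (card J) V F"
proof -
  obtain \<beta> where "bij_betw \<beta> {..<card J} J"
    using ex_bij_betw_nat_finite[OF assms(2)] by (auto simp: atLeast0LessThan)
  then show ?thesis
    using assms rows_independent_on_reindex[of "{..<card J}" V p \<beta> F]
    unfolding realizable_def rows_independent_iff_on bij_betw_def by auto
qed

lemma realizable_rows_independent_on:
  assumes "realizable (card J) V F" "finite J"
  shows "\<exists>p. rows_independent_on J V p F"
proof -
  obtain p where p: "rows_independent_on {..<card J} V p F"
    using assms(1) unfolding realizable_def rows_independent_iff_on by blast
  obtain \<beta> where "bij_betw \<beta> J {..<card J}"
    using ex_bij_betw_finite_nat[OF assms(2)] by (auto simp: atLeast0LessThan)
  then show ?thesis
    using p rows_independent_on_reindex[of J V p \<beta> F] unfolding bij_betw_def by auto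
qed

lemma load_diff_scale: "load F p (\<lambda>e. c e - k * b e) i v = load F p c i v - k * load F p b i v"
  by (simp add: load_def sum_subtractf sum_distrib_left algebra_simps)

lemma load_cong: "(\<And>e. e \<in> F \<Longrightarrow> c e = b e) \<Longrightarrow> load F p c i v = load F p b i v"
  by (simp add: load_def)

lemma load_diff: "finite F \<Longrightarrow> A \<subseteq> F \<Longrightarrow> load (F - A) p c i v = load F p c i v - load A p c i v"
  by (simp add: load_def sum_diff)

lemma load_zero_extend:
  assumes "finite F" "A \<subseteq> F" "\<And>e. e \<in> F - A \<Longrightarrow> c e = 0"
  shows "load F p c i v = load A p c i v"
  unfolding load_def using assms by (intro sum.mono_neutral_right) auto

lemma simple_graph_finite_edges: "simple_graph V E \<Longrightarrow> finite E"
  by (rule finite_subset[of _ "Pow V"]) (auto simp: simple_graph_def)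

lemma simple_graph_edgeE:
  assumes "simple_graph V E" "e \<in> E"
  obtains a b where "a \<in> V" "b \<in> V" "a \<noteq> b" "e = {a, b}"
  using assms unfolding simple_graph_def by blast

lemma rigidity_matrix_poly_fun:
  assumes "a \<in> V" "b \<in> V" "a \<noteq> b" "i \<in> I" "0 \<in> K"
  shows "(\<lambda>p. rigidity_matrix p {a, b} (v, i)) \<in> poly_fun K (V \<times> I)"
proof -
  consider "v = a" | "v = b" | "v \<notin> {a, b}" by blast
  then show ?thesis
    using assms by cases (auto simp: rigidity_matrix_edge intro!: poly_fun.intros)
qed

text \<open>The entries of the rigidity matrix are differences of coordinates, so the elimination
  certificate has coefficients in any \<open>K\<close> that contains \<open>0\<close> and
  \<open>1\<close>.\<close>

lemma rows_independent_on_certificate: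
  assumes "simple_graph V E" "F \<subseteq> E" "rows_independent_on J V p F" "{0, 1} \<subseteq> K"
  shows "\<exists>D\<in>poly_fun K (V \<times> J). D p \<noteq> 0 \<and> (\<forall>q. D q \<noteq> 0 \<longrightarrow> rows_independent_on J V q F)"
proof -
  have "\<exists>D\<in>poly_fun K (V \<times> J). D p \<noteq> 0 \<and> (\<forall>q c. D q \<noteq> 0 \<longrightarrow>
      (\<forall>x\<in>V \<times> J. (\<Sum>e\<in>F. c e * rigidity_matrix q e x) = 0) \<longrightarrow> (\<forall>e\<in>F. c e = (0::real)))"
  proof (rule independence_certificate)
    show "finite F" using assms(1,2) simple_graph_finite_edges finite_subset by blast
    show "1 \<in> K" using assms by simp
  next
    fix e x assume ex: "e \<in> F" "x \<in> V \<times> J"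
    obtain a b where "a \<in> V" "b \<in> V" "a \<noteq> b" "e = {a, b}"
      using assms(1,2) ex simple_graph_edgeE by blast
    then show "(\<lambda>p. rigidity_matrix p e x) \<in> poly_fun K (V \<times> J)"
      using ex assms(4) rigidity_matrix_poly_fun[of a V b "snd x" J K "fst x"] by auto
  next
    fix c assume "\<forall>x\<in>V \<times> J. (\<Sum>e\<in>F. c e * rigidity_matrix p e x) = 0"
    then show "\<forall>e\<in>F. c e = 0"
      using assms(3) unfolding rows_independent_on_def stress_def load_def by auto
  qed
  then obtain D where "D \<in> poly_fun K (V \<times> J)" "D p \<noteq> 0"
    and D: "\<And>q c. D q \<noteq> 0 \<Longrightarrow> \<forall>x\<in>V \<times> J. (\<Sum>e\<in>F. c e * rigidity_matrix q e x) = 0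
      \<Longrightarrow> \<forall>e\<in>F. c e = (0::real)"
    by blast
  moreover have "rows_independent_on J V q F" if "D q \<noteq> 0" for q
    unfolding rows_independent_on_def stress_def load_def using D[OF that] by simp
  ultimately show ?thesis by blast
qed

lemma rows_independent_generic:
  assumes "simple_graph V E" "F \<subseteq> E" "generic d V p" "realizable d V F"
  shows "rows_independent d V p F"
proof -
  obtain p' where "rows_independent_on {..<d} V p' F"
    using assms(4) unfolding realizable_def rows_independent_iff_on by blast
  then obtain D where "D \<in> poly_fun \<rat> (V \<times> {..<d})" "D p' \<noteq> 0"
    "\<And>q. D q \<noteq> 0 \<Longrightarrow> rows_independent_on {..<d} V q F"
    using rows_independent_on_certificate[OF assms(1,2), of "{..<d}" p' \<rat>] by auto
  then show ?thesis
    using poly_fun_nonzero_at_generic[of D V d p p'] assms(3) unfolding rows_independent_iff_on by blast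
qed

text \<open>A realizable set is independent at every generic placement; \<open>p\<close> supplies
  the one that \<open>rigidity_indep\<close> asks for.\<close>

lemma rigidity_indep_iff_realizable:
  assumes "simple_graph V E" "E' \<subseteq> E" "generic d V p"
  shows "rigidity_indep d V E' = (\<lambda>F. F \<subseteq> E' \<and> realizable d V F)"
  using rows_independent_generic[OF assms(1) _ assms(3)] assms(2,3)
  unfolding rigidity_indep_def realizable_def by (intro ext) blast

lemma generic_mono: "generic d V p \<Longrightarrow> d' \<le> d \<Longrightarrow> generic d' V p"
  unfolding generic_def alg_indep_over_rat_def
proof (intro allI impI)
  fix q :: "('a \<times> nat \<Rightarrow>\<^sub>0 nat) \<Rightarrow>\<^sub>0 rat"
  assume gen: "\<forall>q::('a \<times> nat \<Rightarrow>\<^sub>0 nat) \<Rightarrow>\<^sub>0 rat. (\<forall>m\<in>Poly_Mapping.keys q. Poly_Mapping.keys m \<subseteq> V \<times> {..<d}) \<longrightarrow>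
      eval_mpoly (\<lambda>(v, i). p v i) q = 0 \<longrightarrow> q = 0"
    and "d' \<le> d" "\<forall>m\<in>Poly_Mapping.keys q. Poly_Mapping.keys m \<subseteq> V \<times> {..<d'}"
    and 0: "eval_mpoly (\<lambda>(v, i). p v i) q = 0"
  then have "\<forall>m\<in>Poly_Mapping.keys q. Poly_Mapping.keys m \<subseteq> V \<times> {..<d}" by fastforce
  then show "q = 0" using gen 0 by blast
qed

text \<open>There are finitely many pairs of an index set in \<open>\<J>\<close> and a realizable
  edge set; \<open>D\<close> is the product of their certificates.\<close>

lemma poly_fun_regular:
  fixes V :: "'v set"
  assumes "simple_graph V E" "finite \<J>" "\<And>J. J \<in> \<J> \<Longrightarrow> finite J"
  shows "\<exists>D\<in>poly_fun UNIV (V \<times> UNIV). (\<exists>p. D p \<noteq> 0) \<and> (\<forall>p. D p \<noteq> 0 \<longrightarrow> (\<forall>J\<in>\<J>. regular V E p J))"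
proof -
  define \<A> where "\<A> = {(J, F). J \<in> \<J> \<and> F \<subseteq> E \<and> realizable (card J) V F}"
  have "\<A> \<subseteq> \<J> \<times> Pow E" by (auto simp: \<A>_def)
  then have fin: "finite \<A>"
    using assms(2) simple_graph_finite_edges[OF assms(1)] by (simp add: finite_subset)
  have ex: "\<exists>D. D \<in> poly_fun UNIV (V \<times> UNIV) \<and> (\<exists>p. D p \<noteq> 0) \<and>
    (\<forall>q. D q \<noteq> 0 \<longrightarrow> rows_independent_on (fst x) V q (snd x))" if "x \<in> \<A>" for x
  proof -
    obtain J F where x: "x = (J, F)" by fastforce
    have JF: "J \<in> \<J>" "F \<subseteq> E" "realizable (card J) V F" using that by (auto simp: \<A>_def x)
    obtain p where "rows_independent_on J V p F"
      using realizable_rows_independent_on JF assms(3) by blast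
    then obtain D where D: "D \<in> poly_fun UNIV (V \<times> J)" "D p \<noteq> 0"
      "\<forall>q. D q \<noteq> 0 \<longrightarrow> rows_independent_on J V q F"
      using rows_independent_on_certificate[OF assms(1) JF(2), of J p UNIV] by auto
    have "D \<in> poly_fun UNIV (V \<times> UNIV)"
      using D(1) by induction (auto intro: poly_fun.intros)
    then show ?thesis using D unfolding x fst_conv snd_conv by blast
  qed
  have "\<exists>D. \<forall>x\<in>\<A>. D x \<in> poly_fun UNIV (V \<times> UNIV) \<and> (\<exists>p. D x p \<noteq> 0) \<and>
      (\<forall>q. D x q \<noteq> 0 \<longrightarrow> rows_independent_on (fst x) V q (snd x))"
    using ex by (intro bchoice) blast
  then obtain D where D: "\<And>x. x \<in> \<A> \<Longrightarrow> D x \<in> poly_fun UNIV (V \<times> UNIV)"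
    "\<And>x. x \<in> \<A> \<Longrightarrow> \<exists>p. D x p \<noteq> 0"
    "\<And>x q. x \<in> \<A> \<Longrightarrow> D x q \<noteq> 0 \<Longrightarrow> rows_independent_on (fst x) V q (snd x)"
    by blast
  show ?thesis
  proof (intro bexI[of _ "\<lambda>p. \<Prod>x\<in>\<A>. D x p"] conjI allI impI ballI)
    show "\<exists>p. (\<Prod>x\<in>\<A>. D x p) \<noteq> 0"
      using D fin by (intro poly_fun_prod_nonzero[of \<A> UNIV D "V \<times> UNIV"]) auto
    show "(\<lambda>p. \<Prod>x\<in>\<A>. D x p) \<in> poly_fun UNIV (V \<times> UNIV)"
      using D by (intro poly_fun_prod) auto
  next
    fix p J assume p: "(\<Prod>x\<in>\<A>. D x p) \<noteq> 0" and J: "J \<in> \<J>"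
    show "regular V E p J"
      unfolding regular_def
    proof (intro allI impI)
      fix F assume "F \<subseteq> E" "realizable (card J) V F"
      then have "(J, F) \<in> \<A>" using J by (simp add: \<A>_def)
      then show "rows_independent_on J V p F"
        using p fin D(3)[of "(J, F)" p] by auto
    qed
  qed
qed

section \<open>Symmetry of loads and the projective inversion\<close>

lemma sum_rigidity_matrix_mult:
  assumes "finite V" "a \<in> V" "b \<in> V" "a \<noteq> b"
  shows "(\<Sum>v\<in>V. rigidity_matrix p {a, b} (v, i) * x v) = (p a i - p b i) * (x a - x b)"
proof -
  have "(\<Sum>v\<in>V. rigidity_matrix p {a, b} (v, i) * x v)
      = (\<Sum>v\<in>{a, b}. rigidity_matrix p {a, b} (v, i) * x v)"
    using assms by (intro sum.mono_neutral_right) (auto simp: rigidity_matrix_edge)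
  then show ?thesis
    using assms by (simp add: rigidity_matrix_edge algebra_simps)
qed

text \<open>Both sides sum, over the edges \<open>ab\<close> of \<open>F\<close>, the weight times
  \<open>(p a i - p b i) * (p a j - p b j)\<close>, which is symmetric in \<open>i\<close> and
  \<open>j\<close>.\<close>

lemma load_symmetric:
  assumes "simple_graph V E" "F \<subseteq> E"
  shows "(\<Sum>v\<in>V. load F p c i v * p v j) = (\<Sum>v\<in>V. load F p c j v * p v i)"
proof -
  have swap: "(\<Sum>v\<in>V. load F p c i v * p v j)
      = (\<Sum>e\<in>F. c e * (\<Sum>v\<in>V. rigidity_matrix p e (v, i) * p v j))" for i j
    by (simp add: load_def sum_distrib_right sum_distrib_left mult.assoc sum.swap[of _ V])
  show ?thesis
    unfolding swap
  proof (rule sum.cong[OF refl])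
    fix e assume "e \<in> F"
    then obtain a b where "a \<in> V" "b \<in> V" "a \<noteq> b" "e = {a, b}"
      using assms simple_graph_edgeE by blast
    then show "c e * (\<Sum>v\<in>V. rigidity_matrix p e (v, i) * p v j)
        = c e * (\<Sum>v\<in>V. rigidity_matrix p e (v, j) * p v i)"
      using assms(1) by (simp add: sum_rigidity_matrix_mult simple_graph_def)
  qed
qed

text \<open>The projective map exchanging coordinate \<open>0\<close> with the homogenizing one, applied to coordinate
  \<open>0\<close> and the coordinates beyond \<open>d + 1\<close> only; the coordinates \<open>1, \<dots>, d + 1\<close> stay fixed.\<close>

definition inversion :: "nat \<Rightarrow> ('v \<Rightarrow> nat \<Rightarrow> real) \<Rightarrow> 'v \<Rightarrow> nat \<Rightarrow> real" where
  "inversion d p v i = (if i = 0 then 1 / p v 0 else if i \<le> d + 1 then p v i else p v i / p v 0)"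

lemma poly_fun_cong:
  assumes "f \<in> poly_fun K (V \<times> I)" "\<And>v i. v \<in> V \<Longrightarrow> p v i = q v i"
  shows "f p = f q"
  using assms(1) by induction (auto simp: assms(2))

text \<open>A power of the product of all \<open>p v 0\<close> clears the denominators, so a
  non-vanishing condition on the inverted configuration becomes one on \<open>p\<close>.\<close>

lemma poly_fun_inversion:
  assumes "finite V" "f \<in> poly_fun UNIV (V \<times> UNIV)"
  shows "\<exists>g\<in>poly_fun UNIV (V \<times> UNIV). \<exists>n. \<forall>p. (\<forall>v\<in>V. p v 0 \<noteq> 0) \<longrightarrow>
    g p = (\<Prod>v\<in>V. p v 0) ^ n * f (inversion d p)"
  using assms(2)
proof induction
  case (const c)
  then show ?case
    by (intro bexI[of _ "\<lambda>p. c"] exI[of _ 0]) (auto intro: poly_fun.intros)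
next
  case (coord v i)
  then have v: "v \<in> V" by simp
  have rest: "(\<lambda>p. \<Prod>w\<in>V - {v}. p w 0) \<in> poly_fun UNIV (V \<times> UNIV)"
    by (intro poly_fun_prod) (auto intro: poly_fun.intros)
  have whole: "(\<Prod>w\<in>V. p w 0) = p v 0 * (\<Prod>w\<in>V - {v}. p w 0)" for p :: "'a \<Rightarrow> nat \<Rightarrow> real"
    using v assms(1) by (simp add: prod.remove)
  consider "i = 0" | "i \<noteq> 0" "i \<le> d + 1" | "i > d + 1" by linarith
  then show ?case
  proof cases
    case 1
    then show ?thesis using rest v
      by (intro bexI[of _ "\<lambda>p. \<Prod>w\<in>V - {v}. p w 0"] exI[of _ 1]) (auto simp: whole inversion_def)
  next
    case 2
    then show ?thesis using v
      by (intro bexI[of _ "\<lambda>p. p v i"] exI[of _ 0]) (auto simp: inversion_def intro: poly_fun.intros)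
  next
    case 3
    moreover have "(\<lambda>p. (\<Prod>w\<in>V - {v}. p w 0) * p v i) \<in> poly_fun UNIV (V \<times> UNIV)"
      using v by (intro poly_fun.mult[OF rest] poly_fun.coord) simp
    ultimately show ?thesis using v
      by (intro bexI[of _ "\<lambda>p. (\<Prod>w\<in>V - {v}. p w 0) * p v i"] exI[of _ 1])
        (auto simp: whole inversion_def)
  qed
next
  case (add f1 f2)
  then obtain g1 n1 g2 n2 where g: "g1 \<in> poly_fun UNIV (V \<times> UNIV)" "g2 \<in> poly_fun UNIV (V \<times> UNIV)"
    "\<And>p. \<forall>v\<in>V. p v 0 \<noteq> 0 \<Longrightarrow> g1 p = (\<Prod>v\<in>V. p v 0) ^ n1 * f1 (inversion d p)"
    "\<And>p. \<forall>v\<in>V. p v 0 \<noteq> 0 \<Longrightarrow> g2 p = (\<Prod>v\<in>V. p v 0) ^ n2 * f2 (inversion d p)"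
    by blast
  have "(\<lambda>p. (\<Prod>v\<in>V. p v 0) ^ n2 * g1 p + (\<Prod>v\<in>V. p v 0) ^ n1 * g2 p) \<in> poly_fun UNIV (V \<times> UNIV)"
    using g by (intro poly_fun.add poly_fun.mult poly_fun_power poly_fun_prod) (auto intro: poly_fun.intros)
  then show ?case
    by (rule bexI[rotated]) (auto intro!: exI[of _ "n1 + n2"] simp: g power_add algebra_simps)
next
  case (diff f1 f2)
  then obtain g1 n1 g2 n2 where g: "g1 \<in> poly_fun UNIV (V \<times> UNIV)" "g2 \<in> poly_fun UNIV (V \<times> UNIV)"
    "\<And>p. \<forall>v\<in>V. p v 0 \<noteq> 0 \<Longrightarrow> g1 p = (\<Prod>v\<in>V. p v 0) ^ n1 * f1 (inversion d p)"
    "\<And>p. \<forall>v\<in>V. p v 0 \<noteq> 0 \<Longrightarrow> g2 p = (\<Prod>v\<in>V. p v 0) ^ n2 * f2 (inversion d p)"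
    by blast
  have "(\<lambda>p. (\<Prod>v\<in>V. p v 0) ^ n2 * g1 p - (\<Prod>v\<in>V. p v 0) ^ n1 * g2 p) \<in> poly_fun UNIV (V \<times> UNIV)"
    using g by (intro poly_fun.diff poly_fun.mult poly_fun_power poly_fun_prod) (auto intro: poly_fun.intros)
  then show ?case
    by (rule bexI[rotated]) (auto intro!: exI[of _ "n1 + n2"] simp: g power_add algebra_simps)
next
  case (mult f1 f2)
  then obtain g1 n1 g2 n2 where g: "g1 \<in> poly_fun UNIV (V \<times> UNIV)" "g2 \<in> poly_fun UNIV (V \<times> UNIV)"
    "\<And>p. \<forall>v\<in>V. p v 0 \<noteq> 0 \<Longrightarrow> g1 p = (\<Prod>v\<in>V. p v 0) ^ n1 * f1 (inversion d p)"
    "\<And>p. \<forall>v\<in>V. p v 0 \<noteq> 0 \<Longrightarrow> g2 p = (\<Prod>v\<in>V. p v 0) ^ n2 * f2 (inversion d p)"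
    by blast
  have "(\<lambda>p. g1 p * g2 p) \<in> poly_fun UNIV (V \<times> UNIV)"
    using g by (intro poly_fun.mult)
  then show ?case
    by (rule bexI[rotated]) (auto intro!: exI[of _ "n1 + n2"] simp: g power_add algebra_simps)
qed

text \<open>Stresses are carried along projective maps by scaling the weight of an edge \<open>ab\<close> with
  \<open>\<lambda>\<^sub>a \<lambda>\<^sub>b\<close>, where \<open>\<lambda>\<close> is the denominator.\<close>

lemma load_inversion:
  fixes c :: "'v set \<Rightarrow> real"
  assumes "simple_graph V E" "F \<subseteq> E" "\<forall>v\<in>V. p v 0 \<noteq> 0"
  defines "b \<equiv> \<lambda>e. c e * (\<Prod>v\<in>e. p v 0)"
  shows "load F (inversion d p) b 0 v = - load F p c 0 v"
    and "i > d + 1 \<Longrightarrow>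
      load F (inversion d p) b i v = p v 0 * load F p c i v - p v i * load F p c 0 v"
proof -
  \<comment> \<open>With \<open>l\<close> for coordinate \<open>0\<close>, the two edge identities
    at the end \<open>x\<close> of \<open>xy\<close> are
    \<open>l x * l y * (1 / l x - 1 / l y) = - (l x - l y)\<close> and \<open>l y * p x i - l x * p
    y i = l x * (p x i - p y i) - p x i * (l x - l y)\<close>.\<close>
  have edge: "b e * rigidity_matrix (inversion d p) e (v, 0) = - (c e * rigidity_matrix p e (v, 0)) \<and>
     (i > d + 1 \<longrightarrow> b e * rigidity_matrix (inversion d p) e (v, i)
      = p v 0 * (c e * rigidity_matrix p e (v, i)) - p v i * (c e * rigidity_matrix p e (v, 0)))"
    if e: "e \<in> F" for e i
  proof -
    obtain x y where xy: "x \<in> V" "y \<in> V" "x \<noteq> y" "e = {x, y}"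
      using assms(1,2) e simple_graph_edgeE by blast
    then have "p x 0 \<noteq> 0" "p y 0 \<noteq> 0" using assms(3) by auto
    note nz = this
    have b: "b e = c e * p x 0 * p y 0" using xy by (simp add: b_def)
    consider "v = x" | "v = y" | "v \<notin> {x, y}" by blast
    then show ?thesis
    proof cases
      case 1
      then show ?thesis
        using xy nz unfolding b by (simp add: rigidity_matrix_edge inversion_def) (simp add: field_simps)
    next
      case 2
      then show ?thesis
        using xy nz unfolding b by (simp add: rigidity_matrix_edge inversion_def) (simp add: field_simps)
    next
      case 3
      then show ?thesis using xy by (simp add: rigidity_matrix_edge)
    qed
  qed
  show "load F (inversion d p) b 0 v = - load F p c 0 v"
    using edge by (simp add: load_def sum_negf)
  show "load F (inversion d p) b i v = p v 0 * load F p c i v - p v i * load F p c 0 v" if "i > d + 1"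
    using edge that by (simp add: load_def sum_distrib_left sum_subtractf)
qed

section \<open>Circuits and separators of the rigidity matroid in terms of stresses\<close>

lemma circuit_stress:
  assumes "simple_graph V E" and C: "circuit E (\<lambda>F. F \<subseteq> E \<and> realizable (card J) V F) C"
    and "regular V E p J" "finite J"
  obtains c where "stress J V p E c" "supp c = C"
proof -
  have CE: "C \<subseteq> E" and dep: "\<not> realizable (card J) V C"
    and proper: "\<And>D. D \<subset> C \<Longrightarrow> realizable (card J) V D"
    using C unfolding circuit_def by blast+
  have "\<not> rows_independent_on J V p C"
    using rows_independent_on_realizable[OF _ assms(4)] dep by blast
  then obtain c g where c: "stress J V p C c" "g \<in> C" "c g \<noteq> 0"
    unfolding rows_independent_on_def by blast
  define b where "b = (\<lambda>e. if e \<in> C then c e else 0)"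
  have fin: "finite E" using assms(1) by (rule simple_graph_finite_edges)
  have "load E p b i v = load C p b i v" for i v
    using fin CE by (intro load_zero_extend) (auto simp: b_def)
  moreover have bC: "load C p b i v = load C p c i v" for i v
    by (intro load_cong) (simp add: b_def)
  ultimately have "stress J V p E b"
    using c(1) by (simp add: stress_def)
  \<comment> \<open>A zero entry at \<open>e\<close> would make \<open>b\<close> a stress of
    \<open>C - {e}\<close>, a proper subset of the circuit and hence independent at the regular
    \<open>p\<close>; then \<open>b\<close> would vanish at \<open>g\<close>.\<close>
  moreover have "b e \<noteq> 0" if e: "e \<in> C" for e
  proof
    assume "b e = 0"
    then have "load C p b i v = load (C - {e}) p b i v" for i v
      using fin CE finite_subset by (intro load_zero_extend) auto
    then have st: "stress J V p (C - {e}) b"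
      using c(1) bC by (simp add: stress_def)
    have "realizable (card J) V (C - {e})" using e by (intro proper) blast
    then have "rows_independent_on J V p (C - {e})"
      using assms(3) CE unfolding regular_def by blast
    then have "\<forall>f\<in>C - {e}. b f = 0"
      using st unfolding rows_independent_on_def by blast
    then have "b g = 0" using c(2) \<open>b e = 0\<close> by blast
    then show False using c by (simp add: b_def)
  qed
  then have "supp b = C" by (auto simp: supp_def b_def)
  ultimately show ?thesis by (rule that)
qed

definition stress_space where
  "stress_space J V p E = {c. supp c \<subseteq> E \<and> stress J V p E c}"

lemma dependency_space_stress_space:
  assumes "finite E"
  shows "dependency_space E (stress_space J V p E)"
proof
  show "finite E" by (rule assms)
  fix c b :: "'a set \<Rightarrow> real" and k :: real
  show "supp c \<subseteq> E" if "c \<in> stress_space J V p E" using that by (simp add: stress_space_def)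
  assume c: "c \<in> stress_space J V p E" "b \<in> stress_space J V p E"
  have "supp (\<lambda>e. c e - k * b e) \<subseteq> supp c \<union> supp b" by (auto simp: supp_def)
  then show "(\<lambda>e. c e - k * b e) \<in> stress_space J V p E"
    using c by (auto simp: stress_space_def stress_def load_diff_scale)
qed

lemma indep_stress_space:
  assumes "finite E"
  shows "dependency_space.indep E (stress_space J V p E)
    = (\<lambda>F. F \<subseteq> E \<and> rows_independent_on J V p F)"
proof (intro ext iffI)
  interpret dependency_space E "stress_space J V p E"
    using assms by (rule dependency_space_stress_space)
  fix F
  assume F: "indep F"
  have "\<forall>e\<in>F. c e = 0" if c: "stress J V p F c" for c
  proof -
    let ?c = "\<lambda>e. if e \<in> F then c e else 0"
    have FE: "F \<subseteq> E" using F by (simp add: indep_def)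
    have "load E p ?c i v = load F p c i v" for i v
      using load_zero_extend[OF assms FE, of ?c] load_cong[of F ?c c] by simp
    then have "?c \<in> stress_space J V p E"
      using c FE by (auto simp: stress_space_def supp_def stress_def)
    moreover have "supp ?c \<subseteq> F" by (auto simp: supp_def)
    ultimately have "supp ?c = {}" using F unfolding indep_def by blast
    then have "?c e = 0" for e unfolding supp_def by blast
    then show ?thesis by metis
  qed
  then show "F \<subseteq> E \<and> rows_independent_on J V p F"
    using F by (simp add: indep_def rows_independent_on_def)
next
  interpret dependency_space E "stress_space J V p E"
    using assms by (rule dependency_space_stress_space)
  fix F assume F: "F \<subseteq> E \<and> rows_independent_on J V p F"
  have "supp c = {}" if c: "c \<in> stress_space J V p E" "supp c \<subseteq> F" for c
  proof -
    have "load E p c i v = load F p c i v" for i v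
      using F c assms by (intro load_zero_extend) (auto simp: supp_def)
    then have "stress J V p F c" using c by (simp add: stress_space_def stress_def)
    then have "\<forall>e\<in>F. c e = 0" using F by (simp add: rows_independent_on_def)
    then show ?thesis using c by (auto simp: supp_def)
  qed
  then show "indep F" using F by (simp add: indep_def)
qed

lemma rows_independent_on_eq_realizable:
  assumes "regular V E p J" "E' \<subseteq> E" "finite J"
  shows "(\<lambda>F. F \<subseteq> E' \<and> rows_independent_on J V p F) = (\<lambda>F. F \<subseteq> E' \<and> realizable (card J) V F)"
proof (intro ext conj_cong refl iffI)
  fix F assume "F \<subseteq> E'"
  show "realizable (card J) V F" if "rows_independent_on J V p F"
    using that assms(3) by (rule rows_independent_on_realizable)
  show "rows_independent_on J V p F" if "realizable (card J) V F"
    using that assms(1,2) \<open>F \<subseteq> E'\<close> unfolding regular_def by simp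
qed

text \<open>The separator is combinatorial. At a regular placement, however, the realizable subsets
  of \<open>E'\<close> are exactly the independent ones, so the circuits are those of the stress
  space.\<close>

lemma separator_splits_stress:
  assumes "simple_graph V E" "E' \<subseteq> E" "A \<subseteq> E'"
    and "\<And>C. circuit E' (\<lambda>F. F \<subseteq> E' \<and> realizable (card J) V F) C \<Longrightarrow> C \<subseteq> A \<or> C \<inter> A = {}"
    and "regular V E p J" "finite J" "stress J V p E' c"
  shows "stress J V p A c"
proof -
  have fin: "finite E'"
    using assms(1,2) simple_graph_finite_edges finite_subset by blast
  interpret dependency_space E' "stress_space J V p E'"
    using fin by (rule dependency_space_stress_space)
  let ?c = "\<lambda>e. if e \<in> E' then c e else 0"
  let ?b = "\<lambda>e. if e \<in> A then ?c e else 0"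
  have "load E' p ?c i v = load E' p c i v" for i v
    by (intro load_cong) simp
  then have "?c \<in> stress_space J V p E'"
    using assms(7) by (auto simp: stress_space_def stress_def supp_def)
  moreover have "indep = (\<lambda>F. F \<subseteq> E' \<and> realizable (card J) V F)"
    using indep_stress_space[OF fin] rows_independent_on_eq_realizable[OF assms(5,2,6)] by simp
  ultimately have "?b \<in> stress_space J V p E'"
    using separator_splits[of A ?c] assms(4) by simp
  moreover have "load E' p ?b i v = load A p c i v" for i v
  proof -
    have "load A p ?b i v = load A p c i v"
      using assms(3) by (intro load_cong) auto
    then show ?thesis using load_zero_extend[OF fin assms(3), of ?b] by simp
  qed
  ultimately show ?thesis by (simp add: stress_space_def stress_def)
qed

lemma separator_exists_realizable:
  assumes "simple_graph V E" "E' \<subseteq> E"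
    and "\<not> matroid_connected E' (\<lambda>F. F \<subseteq> E' \<and> realizable d V F)"
  obtains A where "A \<subseteq> E'" "A \<noteq> {}" "A \<noteq> E'"
    "\<And>C. circuit E' (\<lambda>F. F \<subseteq> E' \<and> realizable d V F) C \<Longrightarrow> C \<subseteq> A \<or> C \<inter> A = {}"
proof -
  have fin: "finite E'"
    using assms(1,2) simple_graph_finite_edges finite_subset by blast
  obtain p where p: "regular V E p {..<d}"
    using poly_fun_regular[OF assms(1), of "{{..<d}}"] by auto
  interpret dependency_space E' "stress_space {..<d} V p E'"
    using fin by (rule dependency_space_stress_space)
  have indep: "indep = (\<lambda>F. F \<subseteq> E' \<and> realizable d V F)"
    using indep_stress_space[OF fin] rows_independent_on_eq_realizable[OF p assms(2)] by simp
  show ?thesis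
    by (rule separator_exists[unfolded indep, OF assms(3)]) (rule that)
qed

section \<open>Deleting an edge\<close>

lemma ex_subset_card_mem:
  assumes "i \<in> J" "1 \<le> n" "n \<le> card J" "finite J"
  obtains I where "I \<subseteq> J" "card I = n" "i \<in> I"
proof -
  have "n - 1 \<le> card (J - {i})" using assms by simp
  then obtain I where I: "I \<subseteq> J - {i}" "card I = n - 1" "finite I"
    using obtain_subset_with_card_n by metis
  then have "card (insert i I) = n" using assms(2) by (subst card_insert_disjoint) auto
  then show ?thesis using that[of "insert i I"] I assms(1) by auto
qed

text \<open>The situation to be refuted: \<open>A\<close> separates \<open>E - {{s, t}}\<close> in
  dimension \<open>d\<close>, while \<open>{s, t}\<close> carries a stress in dimension
  \<open>d + 1\<close>. Both conditions range over all regular placements, so they apply to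
  projections and to inverted configurations.\<close>

locale split_edge =
  fixes d :: nat and V :: "'v set" and E A :: "'v set set" and s t :: 'v
  assumes d_pos: "d \<ge> 1" and graph: "simple_graph V E"
    and edge: "{s, t} \<in> E" and st: "s \<noteq> t"
    and A_subset: "A \<subseteq> E - {{s, t}}"
    and split: "\<And>J p c. card J = d \<Longrightarrow> finite J \<Longrightarrow> regular V E p J \<Longrightarrow>
      stress J V p (E - {{s, t}}) c \<Longrightarrow> stress J V p A c"
    and ex_stress: "\<And>J p. card J = d + 1 \<Longrightarrow> finite J \<Longrightarrow> regular V E p J \<Longrightarrow>
      \<exists>c. stress J V p E c \<and> c {s, t} = 1"
begin

text \<open>Coordinate \<open>0\<close> is the one to be inverted, \<open>1, ..., d + 1\<close> form
  the framework under study, and the \<open>d\<close> further ones complete \<open>0\<close> to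
  another framework of dimension \<open>d + 1\<close>.\<close>

abbreviation index_set :: "nat set" where "index_set \<equiv> {..2 * d + 1}"

definition good :: "('v \<Rightarrow> nat \<Rightarrow> real) \<Rightarrow> bool" where
  "good p \<longleftrightarrow> (\<forall>J\<subseteq>index_set. card J \<in> {d, d + 1} \<longrightarrow> regular V E p J)"

lemma ends: "s \<in> V" "t \<in> V"
proof -
  obtain a b where "a \<in> V" "b \<in> V" "{s, t} = {a, b}"
    using simple_graph_edgeE[OF graph edge] by metis
  then show "s \<in> V" "t \<in> V" by (auto simp: doubleton_eq_iff)
qed

lemma finite_vertices: "finite V"
  using graph by (simp add: simple_graph_def)

lemma finite_edges: "finite E"
  using graph by (rule simple_graph_finite_edges)

lemma finite_index: "J \<subseteq> index_set \<Longrightarrow> finite J"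
  using finite_subset by blast

lemma good_regular: "good p \<Longrightarrow> J \<subseteq> index_set \<Longrightarrow> card J = d \<or> card J = d + 1 \<Longrightarrow> regular V E p J"
  by (auto simp: good_def)

text \<open>The difference of the two stresses vanishes at \<open>{s, t}\<close>, so it is a stress
  of the remaining edges and \<open>split\<close> applies.\<close>

lemma split_equal_weight:
  assumes "card J = d" "finite J" "regular V E p J" "stress J V p E c" "stress J V p E c'"
    and "c {s, t} = c' {s, t}" "i \<in> J" "v \<in> V"
  shows "load A p c i v = load A p c' i v"
proof -
  let ?b = "\<lambda>e. c e - 1 * c' e"
  have "load E p ?b i v = load (E - {{s, t}}) p ?b i v" for i v
    using finite_edges assms(6) by (intro load_zero_extend) auto
  then have "stress J V p (E - {{s, t}}) ?b"
    using assms(4,5) unfolding stress_def by (metis load_diff_scale diff_zero mult_zero_right)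
  then have "stress J V p A ?b" using split assms(1-3) by blast
  then have "load A p ?b i v = 0" using assms(7,8) by (simp add: stress_def)
  then show ?thesis by (simp only: load_diff_scale)
qed

text \<open>Exchanging the other coordinates one at a time, the load on \<open>A\<close> in direction \<open>i\<close> depends on
  the \<open>i\<close>-th coordinates alone.\<close>

lemma load_unique:
  assumes "good p" "J \<subseteq> index_set" "card J = d + 1" "J' \<subseteq> index_set" "card J' = d + 1"
    and "stress J V p E c" "c {s, t} = 1" "stress J' V p E c'" "c' {s, t} = 1"
    and "i \<in> J" "i \<in> J'" "v \<in> V"
  shows "load A p c i v = load A p c' i v"
  using assms(2-)
proof (induction "card (J' - J)" arbitrary: J c)
  case 0
  have fin: "finite J" "finite J'" using 0 finite_index by blast+
  then have "J' \<subseteq> J" using 0 by auto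
  then have "J = J'" using 0 fin card_subset_eq by metis
  then obtain I where I: "I \<subseteq> J" "I \<subseteq> J'" "card I = d" "i \<in> I"
    using ex_subset_card_mem[of i J d] 0 d_pos fin by auto
  then have sub: "I \<subseteq> index_set" using 0(2) by blast
  have "regular V E p I" "finite I"
    using good_regular[OF assms(1) sub] I(3) finite_index[OF sub] by simp_all
  moreover have "stress I V p E c" "stress I V p E c'"
    using I 0 unfolding stress_def by blast+
  ultimately show ?case
    using I(3,4) 0 by (intro split_equal_weight[of I]) simp_all
next
  case (Suc n)
  have fin: "finite J" "finite J'" using Suc.prems finite_index by blast+
  obtain j where j: "j \<in> J'" "j \<notin> J"
    using Suc.hyps(2) by (metis card.empty Diff_eq_empty_iff nat.distinct(1) subsetI)
  have "card J = card J'" using Suc.prems by simp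
  then have "\<not> J \<subseteq> J'" using j fin card_subset_eq by metis
  then obtain k where k: "k \<in> J" "k \<notin> J'" by blast
  \<comment> \<open>\<open>J\<close> and \<open>L\<close> share the \<open>d\<close> coordinates of
    \<open>J - {k}\<close>, where the loads of \<open>c\<close> and \<open>b\<close> agree. Since
    \<open>i\<close> lies in \<open>J'\<close> and \<open>k\<close> does not, \<open>i\<close> is
    among them.\<close>
  define L where "L = insert j (J - {k})"
  have "card (J - {k}) = d" using k fin Suc.prems by simp
  then have L: "card L = d + 1" "L \<subseteq> index_set" "i \<in> L"
    using j k fin Suc.prems by (auto simp: L_def card_insert_if)
  have finL: "finite L" using L finite_index by blast
  obtain b where b: "stress L V p E b" "b {s, t} = 1"
    using ex_stress[OF L(1) finL] good_regular[OF assms(1) L(2)] L(1) by blast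
  have "J' - L = (J' - J) - {j}" using k by (auto simp: L_def)
  then have "card (J' - L) = n" using Suc.hyps(2) j fin by simp
  then have "load A p b i v = load A p c' i v"
    using L b Suc.prems by (intro Suc.hyps(1)[of L b]) simp_all
  moreover have "load A p c i v = load A p b i v"
  proof (rule split_equal_weight)
    let ?I = "J - {k}"
    show "card ?I = d" "finite ?I" using \<open>card (J - {k}) = d\<close> fin by auto
    then show "regular V E p ?I" using Suc.prems(1) by (intro good_regular[OF assms(1)]) auto
    show "stress ?I V p E c" using Suc.prems unfolding stress_def by blast
    show "stress ?I V p E b" using b unfolding stress_def L_def by blast
    show "i \<in> ?I" using Suc.prems k by auto
  qed (use b Suc.prems in auto)
  ultimately show ?case by simp
qed

section \<open>Comparing loads before and after inversion\<close>

lemma good_stress: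
  assumes "good p" "J \<subseteq> index_set" "card J = d + 1"
  obtains c where "stress J V p E c" "c {s, t} = 1"
  using ex_stress[OF assms(3) finite_index[OF assms(2)]] good_regular[OF assms(1,2)] assms(3) by blast

text \<open>Symmetry of loads is used twice, at \<open>p\<close> and at its inverse. Both times the
  load in direction \<open>k\<close>, paired with coordinate \<open>0\<close>, is traded for the
  load in direction \<open>0\<close>, paired with coordinate \<open>k\<close>. Inversion keeps the
  former load and multiplies the latter by \<open>- 1 / (p s 0 * p t 0)\<close>, so the two
  equations cancel.\<close>

lemma load_reciprocal_identity:
  assumes "good p" "good (inversion d p)" "\<forall>v\<in>V. p v 0 \<noteq> 0"
    and c: "stress {1..d + 1} V p E c" "c {s, t} = 1" and k: "k \<in> {1..d + 1}"
  shows "(\<Sum>w\<in>V. load A p c k w * (p s 0 * p t 0 / p w 0 + p w 0)) = 0"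
proof -
  let ?q = "inversion d p" and ?l = "p s 0 * p t 0"
  have AE: "A \<subseteq> E" using A_subset by blast
  define J1 where "J1 = {1..d + 1}"
  obtain j where j: "j \<in> J1" "j \<noteq> k"
    using k d_pos that[of 1] that[of 2] by (force simp: J1_def)
  \<comment> \<open>\<open>J2\<close> contains both \<open>0\<close> and \<open>k\<close>, as
    symmetry requires. \<open>J1\<close> has only coordinates fixed by \<open>inversion\<close>, and
    \<open>J3\<close> only coordinates it changes; uniqueness of loads links \<open>J2\<close> to
    \<open>J1\<close> at \<open>k\<close> and to \<open>J3\<close> at \<open>0\<close>.\<close>
  define J2 where "J2 = insert 0 (J1 - {j})"
  define J3 where "J3 = insert 0 {d + 2..2 * d + 1}"
  have J1: "J1 \<subseteq> index_set" "card J1 = d + 1" "k \<in> J1" using k by (auto simp: J1_def)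
  have J2: "J2 \<subseteq> index_set" "card J2 = d + 1" "k \<in> J2" "0 \<in> J2"
    using j k by (auto simp: J2_def J1_def)
  have J3: "J3 \<subseteq> index_set" "card J3 = d + 1" "0 \<in> J3" by (auto simp: J3_def)
  have c1: "stress J1 V p E c" using c by (simp add: J1_def)
  have inv1: "?q v i = p v i" if "i \<in> J1" for v i using that by (auto simp: inversion_def J1_def)
  have loadq: "load F ?q b i v = load F p b i v" if "i \<in> J1" for F b i v
  proof -
    have "rigidity_matrix ?q e (v, i) = rigidity_matrix p e (v, i)" for e
      using that by (simp add: rigidity_matrix_def inv1)
    then show ?thesis by (simp add: load_def)
  qed
  have c1q: "stress J1 V ?q E c" using c1 by (simp add: stress_def loadq)
  have l: "?l \<noteq> 0" using assms(3) ends by simp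
  obtain c2 where c2: "stress J2 V p E c2" "c2 {s, t} = 1" using good_stress assms J2 by metis
  obtain b2 where b2: "stress J2 V ?q E b2" "b2 {s, t} = 1" using good_stress assms J2 by metis
  obtain c3 where c3: "stress J3 V p E c3" "c3 {s, t} = 1" using good_stress assms J3 by metis
  \<comment> \<open>Transport along the inversion multiplies the weight of \<open>{s, t}\<close> by
    \<open>?l\<close>; dividing by \<open>?l\<close> first restores weight one.\<close>
  define b3 where "b3 = (\<lambda>e. (c3 e / ?l) * (\<Prod>v\<in>e. p v 0))"
  have load_scale: "load F p (\<lambda>e. c3 e / ?l) i v = load F p c3 i v / ?l" for F i v
    by (simp add: load_def sum_divide_distrib)
  have b3_0: "load F ?q b3 0 v = - load F p c3 0 v / ?l" if "F \<subseteq> E" for F v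
    using load_inversion(1)[of V E F p d "\<lambda>e. c3 e / ?l" v] graph that assms(3)
    by (simp add: b3_def load_scale)
  have "stress J3 V ?q E b3"
    unfolding stress_def
  proof (intro ballI)
    fix i v assume iv: "i \<in> J3" "v \<in> V"
    then have z: "load E p c3 i v = 0" "load E p c3 0 v = 0"
      using c3 J3 by (auto simp: stress_def)
    show "load E ?q b3 i v = 0"
    proof (cases "i = 0")
      case True
      then show ?thesis using b3_0[of E] z by simp
    next
      case False
      then have "i > d + 1" using iv by (auto simp: J3_def)
      then show ?thesis
        using load_inversion(2)[of V E E p d i "\<lambda>e. c3 e / ?l" v] graph assms(3) z
        by (simp add: b3_def load_scale)
    qed
  qed
  moreover have "b3 {s, t} = 1" using c3 l st by (simp add: b3_def)
  ultimately have b20: "load A ?q b2 0 v = load A ?q b3 0 v" if "v \<in> V" for v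
    using load_unique[OF assms(2) J2(1,2) J3(1,2) b2 _ _ J2(4) J3(3) that] by blast
  have c20: "load A p c2 0 v = load A p c3 0 v" if "v \<in> V" for v
    using load_unique[OF assms(1) J2(1,2) J3(1,2) c2 c3 J2(4) J3(3) that] .
  have c2k: "load A p c2 k v = load A p c k v" if "v \<in> V" for v
    using load_unique[OF assms(1) J2(1,2) J1(1,2) c2 c1 c(2) J2(3) J1(3) that] .
  have b2k: "load A ?q b2 k v = load A p c k v" if "v \<in> V" for v
    using load_unique[OF assms(2) J2(1,2) J1(1,2) b2 c1q c(2) J2(3) J1(3) that] loadq J1 by simp
  have "(\<Sum>v\<in>V. load A p c k v * p v 0) = (\<Sum>v\<in>V. load A p c2 k v * p v 0)"
    using c2k by simp
  also have "\<dots> = (\<Sum>v\<in>V. load A p c2 0 v * p v k)"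
    using graph AE by (rule load_symmetric)
  finally have 1: "(\<Sum>v\<in>V. load A p c k v * p v 0) = (\<Sum>v\<in>V. load A p c3 0 v * p v k)"
    using c20 by simp
  have "(\<Sum>v\<in>V. load A p c k v * (1 / p v 0)) = (\<Sum>v\<in>V. load A ?q b2 k v * ?q v 0)"
    using b2k by (simp add: inversion_def)
  also have "\<dots> = (\<Sum>v\<in>V. load A ?q b2 0 v * ?q v k)"
    using graph AE by (rule load_symmetric)
  also have "\<dots> = (\<Sum>v\<in>V. - (load A p c3 0 v * p v k) / ?l)"
    using b20 b3_0[OF AE] inv1 J1 by simp
  also have "\<dots> = - (\<Sum>v\<in>V. load A p c3 0 v * p v k) / ?l"
    by (simp add: sum_divide_distrib sum_negf)
  finally have 2: "?l * (\<Sum>v\<in>V. load A p c k v * (1 / p v 0))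
      = - (\<Sum>v\<in>V. load A p c3 0 v * p v k)"
    using l by simp
  have "(\<Sum>w\<in>V. load A p c k w * (?l / p w 0 + p w 0))
      = ?l * (\<Sum>v\<in>V. load A p c k v * (1 / p v 0)) + (\<Sum>v\<in>V. load A p c k v * p v 0)"
    by (simp add: sum_distrib_left sum.distrib[symmetric] algebra_simps)
  then show ?thesis using 1 2 by simp
qed

lemma poly_fun_good:
  obtains D p where "D \<in> poly_fun UNIV (V \<times> UNIV)" "D p \<noteq> 0"
    "\<And>p. D p \<noteq> 0 \<Longrightarrow> good p \<and> good (inversion d p) \<and> (\<forall>v\<in>V. p v 0 \<noteq> 0) \<and> p s 1 \<noteq> p t 1"
proof -
  let ?X = "V \<times> (UNIV :: nat set)"
  define \<Pi> :: "('v \<Rightarrow> nat \<Rightarrow> real) \<Rightarrow> real" where "\<Pi> = (\<lambda>p. \<Prod>v\<in>V. p v 0)"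
  have \<Pi>: "\<Pi> \<in> poly_fun UNIV ?X"
    unfolding \<Pi>_def by (intro poly_fun_prod) (auto intro: poly_fun.intros)
  have \<Pi>_nz: "\<Pi> p \<noteq> 0 \<longleftrightarrow> (\<forall>v\<in>V. p v 0 \<noteq> 0)" for p
    using finite_vertices by (simp add: \<Pi>_def)
  define \<J> where "\<J> = {J. J \<subseteq> index_set \<and> card J \<in> {d, d + 1}}"
  have "finite \<J>" by (simp add: \<J>_def)
  moreover have "finite J" if "J \<in> \<J>" for J using that finite_index by (simp add: \<J>_def)
  ultimately obtain D0 p0 where D0: "D0 \<in> poly_fun UNIV ?X" "D0 p0 \<noteq> 0"
    "\<And>p. D0 p \<noteq> 0 \<Longrightarrow> \<forall>J\<in>\<J>. regular V E p J"
    using poly_fun_regular[OF graph, of \<J>] by blast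
  have good_D0: "good p" if "D0 p \<noteq> 0" for p
    using D0(3)[OF that] by (simp add: good_def \<J>_def)
  obtain D1 n where D1: "D1 \<in> poly_fun UNIV ?X"
    "\<And>p. \<forall>v\<in>V. p v 0 \<noteq> 0 \<Longrightarrow> D1 p = \<Pi> p ^ n * D0 (inversion d p)"
    using poly_fun_inversion[OF finite_vertices D0(1), of d] unfolding \<Pi>_def by blast
  define D2 :: "('v \<Rightarrow> nat \<Rightarrow> real) \<Rightarrow> real" where "D2 = (\<lambda>p. p s 1 - p t 1)"
  have D2: "D2 \<in> poly_fun UNIV ?X"
    unfolding D2_def using ends by (intro poly_fun.diff poly_fun.coord) auto
  \<comment> \<open>On \<open>V\<close>, \<open>inversion\<close> is an involution wherever
    coordinate \<open>0\<close> has no zeros. Hence \<open>D1\<close> is nonzero at the inverse of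
    any such point at which \<open>D0\<close> is nonzero.\<close>
  have "\<exists>p. D1 p \<noteq> 0"
  proof -
    have one: "\<Pi> (\<lambda>v i. 1) \<noteq> 0" by (simp add: \<Pi>_def)
    obtain t q where "q = (\<lambda>v i. p0 v i + t * (1 - p0 v i))" and q: "D0 q \<noteq> 0" "\<Pi> q \<noteq> 0"
      by (rule poly_fun_common_nonzero[where f = D0 and g = \<Pi> and p = p0 and q = "\<lambda>v i. 1",
            OF D0(1) \<Pi> D0(2) one])
    have nz: "\<forall>v\<in>V. inversion d q v 0 \<noteq> 0" using q by (simp add: \<Pi>_nz inversion_def)
    have "D0 (inversion d (inversion d q)) = D0 q"
      using q by (intro poly_fun_cong[OF D0(1)]) (auto simp: \<Pi>_nz inversion_def)
    moreover have "\<Pi> (inversion d q) \<noteq> 0" using nz by (rule \<Pi>_nz[THEN iffD2])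
    ultimately have "D1 (inversion d q) \<noteq> 0"
      using D1(2)[of "inversion d q"] nz q by simp
    then show ?thesis by blast
  qed
  moreover have "\<exists>p. D2 p \<noteq> 0"
    using st by (intro exI[of _ "\<lambda>v i. if v = s then 1 else 0"]) (simp add: D2_def)
  moreover have "\<exists>p. \<Pi> p \<noteq> 0" by (intro exI[of _ "\<lambda>v i. 1"]) (simp add: \<Pi>_def)
  ultimately have "\<exists>p. (\<Prod>f\<in>{D0, D1, D2, \<Pi>}. f p) \<noteq> 0"
    using D0 D1 D2 \<Pi> by (intro poly_fun_prod_nonzero[of _ UNIV "\<lambda>f. f" ?X]) auto
  then obtain p where p: "D0 p \<noteq> 0" "D1 p \<noteq> 0" "D2 p \<noteq> 0" "\<Pi> p \<noteq> 0"
    by (auto simp: prod_zero_iff)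
  show ?thesis
  proof (rule that[of "\<lambda>p. D0 p * D1 p * D2 p * \<Pi> p" p])
    show "(\<lambda>p. D0 p * D1 p * D2 p * \<Pi> p) \<in> poly_fun UNIV ?X"
      using D0 D1 D2 \<Pi> by (intro poly_fun.mult)
    show "D0 p * D1 p * D2 p * \<Pi> p \<noteq> 0" using p by simp
  next
    fix q assume "D0 q * D1 q * D2 q * \<Pi> q \<noteq> 0"
    then have q: "D0 q \<noteq> 0" "D1 q \<noteq> 0" "D2 q \<noteq> 0" "\<forall>v\<in>V. q v 0 \<noteq> 0" by (auto simp: \<Pi>_nz)
    then have "D0 (inversion d q) \<noteq> 0" using D1(2)[of q] by auto
    then show "good q \<and> good (inversion d q) \<and> (\<forall>v\<in>V. q v 0 \<noteq> 0) \<and> q s 1 \<noteq> q t 1"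
      using q good_D0 by (simp add: D2_def)
  qed
qed

lemma load_proportional:
  obtains p c k where "good p" "stress {1..d + 1} V p E c" "c {s, t} = 1"
    "\<And>i v. i \<in> {1..d + 1} \<Longrightarrow> v \<in> V \<Longrightarrow> load A p c i v = k * rigidity_matrix p {s, t} (v, i)"
proof -
  obtain D p where D: "D \<in> poly_fun UNIV (V \<times> UNIV)" "D p \<noteq> 0"
    and good: "\<And>p. D p \<noteq> 0 \<Longrightarrow> good p \<and> good (inversion d p) \<and> (\<forall>v\<in>V. p v 0 \<noteq> 0) \<and> p s 1 \<noteq> p t 1"
    by (rule poly_fun_good) blast
  let ?J = "{1..d + 1}"
  have "?J \<subseteq> index_set" by auto
  then obtain c where c: "stress ?J V p E c" "c {s, t} = 1"
    using good_stress[of p ?J] good D by auto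
  define h where "h = load A p c"
  \<comment> \<open>The loads \<open>h i\<close> depend only on coordinates
    \<open>1, ..., d + 1\<close>, so coordinate \<open>0\<close> may vary. If the identity with
    denominators cleared, \<open>G\<close>, failed at \<open>x\<close>, then some point on the line
    from \<open>p\<close> to \<open>q\<close> would satisfy \<open>D\<close> and still violate
    it.\<close>
  have identity: "(\<Sum>w\<in>V. h i w * (x s * x t / x w + x w)) = 0"
    if x: "\<forall>v\<in>V. x v \<noteq> 0" and i: "i \<in> ?J" for x i
  proof -
    define G :: "('v \<Rightarrow> nat \<Rightarrow> real) \<Rightarrow> real" where
      "G = (\<lambda>q. \<Sum>w\<in>V. h i w * (q s 0 * q t 0 * (\<Prod>v\<in>V - {w}. q v 0) + q w 0 * (\<Prod>v\<in>V. q v 0)))"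
    have G_eq: "G q = (\<Prod>v\<in>V. q v 0) * (\<Sum>w\<in>V. h i w * (q s 0 * q t 0 / q w 0 + q w 0))"
      if "\<forall>v\<in>V. q v 0 \<noteq> 0" for q
    proof -
      have "(\<Prod>v\<in>V. q v 0) = q w 0 * (\<Prod>v\<in>V - {w}. q v 0)" if "w \<in> V" for w
        using that finite_vertices by (simp add: prod.remove)
      then have "h i w * (q s 0 * q t 0 * (\<Prod>v\<in>V - {w}. q v 0) + q w 0 * (\<Prod>v\<in>V. q v 0))
          = (\<Prod>v\<in>V. q v 0) * (h i w * (q s 0 * q t 0 / q w 0 + q w 0))" if "w \<in> V" for w
        using that \<open>\<forall>v\<in>V. q v 0 \<noteq> 0\<close> by (simp add: field_simps)
      then show ?thesis unfolding G_def sum_distrib_left by (intro sum.cong) auto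
    qed
    have G: "G \<in> poly_fun UNIV (V \<times> UNIV)"
      unfolding G_def using ends
      by (intro poly_fun_sum poly_fun.add poly_fun.mult poly_fun_prod) (auto intro: poly_fun.intros)
    define q where "q = (\<lambda>v i. if i = 0 then x v else p v i)"
    have "G q = 0"
    proof (rule ccontr)
      assume Gq: "G q \<noteq> 0"
      obtain \<tau> r where r_def: "r = (\<lambda>v i. p v i + \<tau> * (q v i - p v i))"
        and r: "D r \<noteq> 0" "G r \<noteq> 0"
        by (rule poly_fun_common_nonzero[where f = D and g = G and p = p and q = q, OF D(1) G D(2) Gq])
      have load_r: "load F r b i v = load F p b i v" if "i \<in> ?J" for F b i v
      proof -
        have "r v i = p v i" for v using that by (simp add: r_def q_def)
        then have "rigidity_matrix r e (v, i) = rigidity_matrix p e (v, i)" for e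
          by (simp add: rigidity_matrix_def)
        then show ?thesis by (simp add: load_def)
      qed
      then have "stress ?J V r E c" using c by (simp add: stress_def)
      then have "(\<Sum>w\<in>V. load A r c i w * (r s 0 * r t 0 / r w 0 + r w 0)) = 0"
        using load_reciprocal_identity[of r c i] good[OF r(1)] c i by blast
      then have "G r = 0" using G_eq[of r] good[OF r(1)] i load_r by (simp add: h_def)
      then show False using r by simp
    qed
    moreover have "\<forall>v\<in>V. q v 0 \<noteq> 0" using x by (simp add: q_def)
    ultimately show ?thesis using G_eq[of q] x finite_vertices by (simp add: q_def)
  qed
  have h0: "h i w = 0" if i: "i \<in> ?J" and w: "w \<in> V" "w \<notin> {s, t}" for i w
  proof -
    \<comment> \<open>Changing the all-ones vector at \<open>w\<close> alone changes only the
      summand of \<open>w\<close>, since \<open>x s\<close> and \<open>x t\<close> stay one; the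
      factor there goes from \<open>2\<close> to \<open>1 / 2 + 2\<close>.\<close>
    define x where "x = (\<lambda>v. if v = w then 2 else 1 :: real)"
    have "(\<Sum>v\<in>V. h i v * 2) = 0" using identity[of "\<lambda>v. 1" i] i by simp
    moreover have "(\<Sum>v\<in>V. h i v * (x s * x t / x v + x v)) = 0"
      using i by (intro identity) (auto simp: x_def)
    ultimately have "(\<Sum>v\<in>V. h i v * (x s * x t / x v + x v) - h i v * 2) = 0"
      by (simp add: sum_subtractf)
    moreover have "(\<Sum>v\<in>V. h i v * (x s * x t / x v + x v) - h i v * 2)
        = (\<Sum>v\<in>{w}. h i v * (x s * x t / x v + x v) - h i v * 2)"
      using w finite_vertices by (intro sum.mono_neutral_right) (auto simp: x_def)
    ultimately show ?thesis using w by (auto simp: x_def)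
  qed
  have sum_ends: "(\<Sum>v\<in>V. h i v * y v) = h i s * y s + h i t * y t" if "i \<in> ?J" for i and y :: "'v \<Rightarrow> real"
  proof -
    have "(\<Sum>v\<in>V. h i v * y v) = (\<Sum>v\<in>{s, t}. h i v * y v)"
      using that h0 ends finite_vertices by (intro sum.mono_neutral_right) auto
    then show ?thesis using st by simp
  qed
  have ht: "h i t = - h i s" if "i \<in> ?J" for i
    using identity[of "\<lambda>v. 1" i] sum_ends[of i "\<lambda>v. 2"] that by simp
  have pst: "p s 1 - p t 1 \<noteq> 0" using good[OF D(2)] by simp
  define k where "k = h 1 s / (p s 1 - p t 1)"
  have hs: "h i s = k * (p s i - p t i)" if i: "i \<in> ?J" for i
  proof -
    \<comment> \<open>Pairing direction \<open>i\<close> with direction \<open>1\<close> by symmetry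
      makes the factor \<open>k\<close> the same for all \<open>i\<close>.\<close>
    have 1: "1 \<in> ?J" by simp
    have "(\<Sum>v\<in>V. h i v * p v 1) = (\<Sum>v\<in>V. h 1 v * p v i)"
      unfolding h_def using graph A_subset by (intro load_symmetric[of V E]) auto
    then have "h i s * (p s 1 - p t 1) = h 1 s * (p s i - p t i)"
      using sum_ends[OF i] sum_ends[OF 1] ht[OF i] ht[OF 1] by (simp add: algebra_simps)
    then show ?thesis using pst by (simp add: k_def field_simps)
  qed
  show ?thesis
  proof (rule that[of p c k])
    show "good p" using good D by blast
    fix i v assume i: "i \<in> ?J" and v: "v \<in> V"
    consider "v = s" | "v = t" | "v \<notin> {s, t}" by blast
    then show "load A p c i v = k * rigidity_matrix p {s, t} (v, i)"
    proof cases
      case 1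
      then show ?thesis using hs[OF i] st by (simp add: h_def rigidity_matrix_edge)
    next
      case 2
      then show ?thesis using hs[OF i] ht[OF i] st by (simp add: h_def rigidity_matrix_edge algebra_simps)
    next
      case 3
      then show ?thesis using h0[OF i v] st by (simp add: h_def rigidity_matrix_edge)
    qed
  qed (use c in auto)
qed

text \<open>The load of \<open>A\<close> is \<open>k\<close> times the row of \<open>{s, t}\<close>.
  If \<open>k \<noteq> 0\<close>, then \<open>A\<close> together with this edge carries a stress; if
  \<open>k = 0\<close>, then \<open>A\<close> is balanced by itself and the rest together with the
  edge carries one.\<close>

lemma stress_concentrated:
  obtains p X b where "good p" "X = A \<or> X = E - {{s, t}} - A" "stress {1..d + 1} V p E b"
    "b {s, t} \<noteq> 0" "\<forall>e\<in>X. b e = 0"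
proof -
  obtain p c k where p: "good p" and c: "stress {1..d + 1} V p E c" "c {s, t} = 1"
    and k: "\<And>i v. i \<in> {1..d + 1} \<Longrightarrow> v \<in> V \<Longrightarrow> load A p c i v = k * rigidity_matrix p {s, t} (v, i)"
    by (rule load_proportional) blast
  let ?e = "{s, t}" and ?J = "{1..d + 1}"
  \<comment> \<open>\<open>m\<close> merges both cases: for \<open>m = 0\<close>, \<open>b\<close>
    is \<open>c\<close> on \<open>A\<close> and \<open>- k\<close> on the edge; for
    \<open>m = 1\<close>, it is \<open>c\<close> off \<open>A\<close>.\<close>
  define m where "m = (if k = 0 then 1 else 0 :: real)"
  define b where "b = (\<lambda>e. if e \<in> A then (1 - m) * c e else if e = ?e then m - (1 - m) * k else m * c e)"
  have E: "E = insert ?e (A \<union> (E - {?e} - A))" using edge A_subset by blast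
  have load_E: "load E p x i v = x ?e * rigidity_matrix p ?e (v, i) + load A p x i v
      + load (E - {?e} - A) p x i v" for x i v
  proof -
    have fin: "finite A" "finite (E - {?e} - A)"
      using finite_edges A_subset by (auto intro: finite_subset)
    have "load E p x i v = load (insert ?e (A \<union> (E - {?e} - A))) p x i v" using E by simp
    also have "\<dots> = x ?e * rigidity_matrix p ?e (v, i) + load (A \<union> (E - {?e} - A)) p x i v"
      unfolding load_def using fin A_subset by (subst sum.insert) auto
    also have "load (A \<union> (E - {?e} - A)) p x i v = load A p x i v + load (E - {?e} - A) p x i v"
      unfolding load_def using fin by (intro sum.union_disjoint) auto
    finally show ?thesis by simp
  qed
  have bA: "load A p b i v = (1 - m) * load A p c i v" for i v
    by (simp add: load_def b_def sum_distrib_left mult.assoc)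
  have bB: "load (E - {?e} - A) p b i v = m * load (E - {?e} - A) p c i v" for i v
    by (simp add: load_def b_def sum_distrib_left mult.assoc)
  have be: "b ?e = m - (1 - m) * k" using A_subset by (auto simp: b_def)
  have "load E p b i v = 0" if iv: "i \<in> ?J" "v \<in> V" for i v
  proof -
    have "load E p c i v = 0" using c(1) iv by (simp add: stress_def)
    then have "load (E - {?e} - A) p c i v = - (1 + k) * rigidity_matrix p ?e (v, i)"
      using load_E[of c i v] c(2) k[OF iv] by (simp add: algebra_simps)
    then have "load E p b i v = (m - (1 - m) * k) * rigidity_matrix p ?e (v, i)
        + (1 - m) * (k * rigidity_matrix p ?e (v, i)) + m * (- (1 + k) * rigidity_matrix p ?e (v, i))"
      by (simp only: load_E[of b] bA bB be k[OF iv])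
    then show ?thesis by (simp add: m_def)
  qed
  then have st: "stress ?J V p E b" by (simp add: stress_def)
  show ?thesis
  proof (cases "k = 0")
    case True
    then show ?thesis using that[OF p _ st, of A] be by (simp add: m_def b_def)
  next
    case False
    then show ?thesis
      using that[OF p _ st, of "E - {?e} - A"] be by (simp add: m_def b_def)
  qed
qed

end

text \<open>A stress \<open>b\<close> that is nonzero at \<open>e\<close> and zero on
  \<open>X\<close> corrects any stress of dimension \<open>d + 1\<close> to weight zero at
  \<open>e\<close> without changing it on \<open>X\<close>. Thus the splitting of dimension
  \<open>d\<close> lifts, and a circuit through \<open>e\<close> and an edge of \<open>X\<close>
  would contain a smaller dependent set.\<close>

theorem rigidity_connected_delete_edge:
  fixes V :: "'v set" and E :: "'v set set"
  assumes d: "d \<ge> 1" and graph: "simple_graph V E" and conn: "rigidity_connected (d + 1) V E"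
    and e: "e \<in> E"
  shows "rigidity_connected d V (E - {e})"
proof (rule ccontr)
  assume not: "\<not> rigidity_connected d V (E - {e})"
  then obtain f where f: "f \<in> E" "f \<noteq> e"
    unfolding rigidity_connected_def matroid_connected_def by blast
  then obtain C where "circuit E (rigidity_indep (d + 1) V E) C" "e \<in> C"
    using conn e unfolding rigidity_connected_def matroid_connected_def by metis
  \<comment> \<open>Independence of the empty set, a proper subset of \<open>C\<close>, provides a
    generic placement.\<close>
  then have "rigidity_indep (d + 1) V E {}"
    unfolding circuit_def by blast
  then obtain p where gen: "generic (d + 1) V p"
    unfolding rigidity_indep_def by blast
  have finE: "finite E" using graph by (rule simple_graph_finite_edges)
  obtain s t where st: "s \<noteq> t" "e = {s, t}" using simple_graph_edgeE[OF graph e] by metis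
  have indep: "rigidity_indep (d + 1) V E = (\<lambda>F. F \<subseteq> E \<and> realizable (d + 1) V F)"
    "rigidity_indep d V (E - {e}) = (\<lambda>F. F \<subseteq> E - {e} \<and> realizable d V F)"
    using rigidity_indep_iff_realizable[OF graph] gen generic_mono[OF gen, of d] by auto
  have circuits: "\<exists>C. circuit E (\<lambda>F. F \<subseteq> E \<and> realizable (d + 1) V F) C \<and> e \<in> C \<and> g \<in> C"
    if "g \<in> E" "g \<noteq> e" for g
    using conn e that unfolding rigidity_connected_def matroid_connected_def indep by metis
  obtain A where A: "A \<subseteq> E - {e}" "A \<noteq> {}" "A \<noteq> E - {e}"
    and sep: "\<And>C. circuit (E - {e}) (\<lambda>F. F \<subseteq> E - {e} \<and> realizable d V F) C \<Longrightarrow> C \<subseteq> A \<or> C \<inter> A = {}"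
    using separator_exists_realizable[OF graph _ not[unfolded rigidity_connected_def indep]] by blast
  have split_A: "stress J V p A c"
    if "card J = d" "finite J" "regular V E p J" "stress J V p (E - {e}) c" for J p c
    using separator_splits_stress[OF graph _ A(1), of J p c] sep that by auto
  interpret edge: split_edge d V E A s t
  proof
    show "d \<ge> 1" "simple_graph V E" "{s, t} \<in> E" "s \<noteq> t" "A \<subseteq> E - {{s, t}}"
      using d graph e st A(1) by simp_all
    show "stress J V p A c"
      if "card J = d" "finite J" "regular V E p J" "stress J V p (E - {{s, t}}) c" for J p c
      using split_A[OF that[folded st(2)]] .
    show "\<exists>c. stress J V p E c \<and> c {s, t} = 1"
      if J: "card J = d + 1" "finite J" "regular V E p J" for J p
    proof -
      obtain C where C: "circuit E (\<lambda>F. F \<subseteq> E \<and> realizable (card J) V F) C" "e \<in> C"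
        using circuits[OF f] J by auto
      obtain c where c: "stress J V p E c" "supp c = C"
        using circuit_stress[OF graph C(1) J(3,2)] .
      have "load E p (\<lambda>f. c f / c e) i v = load E p c i v / c e" for i v
        by (simp add: load_def sum_divide_distrib)
      then have "stress J V p E (\<lambda>f. c f / c e)" using c(1) by (simp add: stress_def)
      moreover have "c e / c e = 1" using c(2) C(2) by (auto simp: supp_def)
      ultimately show ?thesis using st(2) by blast
    qed
  qed
  let ?J = "{1..d + 1}"
  obtain p X b where p: "edge.good p" and X: "X = A \<or> X = E - {{s, t}} - A"
    and b: "stress ?J V p E b" "b {s, t} \<noteq> 0" "\<forall>e\<in>X. b e = 0"
    by (rule edge.stress_concentrated)
  have XE: "X \<subseteq> E - {e}" using X A(1) unfolding st(2) by blast
  have X_ne: "X \<noteq> {}" using X A unfolding st(2) by blast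
  have split_X: "stress J V p X c"
    if "card J = d" "finite J" "regular V E p J" "stress J V p (E - {e}) c" for J c
  proof -
    have "stress J V p A c" using split_A[OF that] .
    then have "stress J V p (E - {e} - A) c"
      using that(4) finE A(1) by (simp add: stress_def load_diff)
    then show ?thesis using X \<open>stress J V p A c\<close> st(2) by blast
  qed
  have stress_X: "stress ?J V p X c" if c: "stress ?J V p E c" for c
    unfolding stress_def
  proof (intro ballI)
    fix i v assume i: "i \<in> ?J" and v: "v \<in> V"
    obtain I where I: "I \<subseteq> ?J" "card I = d" "i \<in> I"
      using ex_subset_card_mem[OF i d] by auto
    have finI: "finite I" using I(1) finite_subset by blast
    have "I \<subseteq> {..2 * d + 1}" using I(1) by auto
    then have reg: "regular V E p I" using edge.good_regular[OF p] I(2) by blast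
    \<comment> \<open>The splitting is applied to a projection to \<open>d\<close> coordinates that
      include \<open>i\<close>, after the weight at \<open>e\<close> has been removed.\<close>
    define a where "a = (\<lambda>f. c f - (c e / b e) * b f)"
    have "load (E - {e}) p a i v = load E p a i v" for i v
      using b(2) st(2) finE by (intro load_zero_extend[symmetric]) (auto simp: a_def)
    moreover have "load E p a i v = 0" if "i \<in> I" "v \<in> V" for i v
    proof -
      have "load E p b i v = 0" "load E p c i v = 0"
        using b(1) c I(1) that unfolding stress_def by blast+
      then show ?thesis unfolding a_def load_diff_scale by simp
    qed
    ultimately have "stress I V p (E - {e}) a" by (simp add: stress_def)
    then have "stress I V p X a" using split_X I(2) finI reg by blast
    moreover have "load X p a i v = load X p c i v"
      using b(3) by (intro load_cong) (simp add: a_def)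
    ultimately show "load X p c i v = 0" using I(3) v by (simp add: stress_def)
  qed
  obtain g where g: "g \<in> X" using X_ne by blast
  then obtain C where C: "circuit E (\<lambda>F. F \<subseteq> E \<and> realizable (card ?J) V F) C" "e \<in> C" "g \<in> C"
    using circuits[of g] XE by auto
  have regJ: "regular V E p ?J" using p by (intro edge.good_regular) auto
  obtain c where c: "stress ?J V p E c" "supp c = C"
    using circuit_stress[OF graph C(1) regJ finite_atLeastAtMost] .
  have "finite X" using XE finE by (auto intro: finite_subset)
  \<comment> \<open>\<open>X \<inter> C\<close> misses \<open>e\<close>, so it is independent as a
    proper subset of \<open>C\<close>; but \<open>c\<close> restricts to a stress of it that is
    nonzero at \<open>g\<close>.\<close>
  then have "load X p c i v = load (X \<inter> C) p c i v" for i v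
    using c(2) by (intro load_zero_extend) (auto simp: supp_def)
  then have "stress ?J V p (X \<inter> C) c" using stress_X[OF c(1)] by (simp add: stress_def)
  moreover have sub: "X \<inter> C \<subset> C" "X \<inter> C \<subseteq> E" using C(2) XE by auto
  have "realizable (card ?J) V (X \<inter> C)" using C(1) sub(1) unfolding circuit_def by blast
  then have "rows_independent_on ?J V p (X \<inter> C)"
    using regJ sub(2) unfolding regular_def by simp
  ultimately have "c g = 0" using g C(3) unfolding rows_independent_on_def by blast
  then show False using c(2) C(3) by (auto simp: supp_def)
qed

theorem theorem4p17:
  fixes d :: nat and V :: "'v set" and E :: "'v set set"
  assumes "d \<ge> 1"
    and "simple_graph V E"
    and "E \<noteq> {}"
    and "rigidity_connected (d + 1) V E"
  shows "\<exists>e\<in>E. rigidity_connected d V (E - {e})"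
  using rigidity_connected_delete_edge[OF assms(1,2,4)] assms(3) by blast

end
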